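(* Let $X$ be a linear diffusion on $\mathcal I=(0,\beta)$ (i.e. $\alpha=0$) as described in the context. Assume (Case (I)) that $S(0)=0$, $S(\beta)=\infty$ and $\lim_{b\to\beta}\mathbb P_x(\tau_b<\infty)b^2=0$. Let $x\in(0,\beta)$ be fixed and consider the two-player zero-sum game with payoff $A((a,b),c)$ defined in the context. Then there exist optimal strategies $c^*$ (for the inf-player) and $y^*$ (for the sup-player) such that the value $V$ of the game is $$V=A(y^*,c^* ).$$ Here $c^*$ is the unique pure strategy on $[0,M_x]$ that minimizes $$\sup_{(a,b)\in[0,x]\times[x,B_x]}A((a,b),c).$$ Furthermore, $y^*$ is (potentially) a mixed strategy of the form $\xi_p(a^*,b^* )+(1-\xi_p)(0,z_{c^*})$ for some $(a^*,b^* )\in[0,x]\times[x,B_x]$ and some $p\in[0,1]$, where $\xi_p$ is a Bernoulli random variable with parameter $p$. Moreover, $(a^*,b^* )$ and $(0,z_{c^*})$ are essential strategies.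
   Context: Setting. $X=(X_t)_{t\ge 0}$ is a regular linear diffusion, evolving on an interval $\mathcal I=(\alpha,\beta)$ with here $\alpha=0$; $\mathbb P_x,\mathbb E_x$ refer to $X_0=x$. The boundaries may be natural, exit, entrance, killing or absorbing. On the interior of $\mathcal I$ the diffusion is regular (from any interior point it hits any other interior point with positive probability), it does not die inside the state space, and its scale function $S$ and speed measure are continuous. $S$ is increasing and continuous and $\mathbb P_x(\tau_b<\tau_a)=\frac{S(x)-S(a)}{S(b)-S(a)}$ for $0<a<x<b<\beta$; boundary values of $S$ are limits. Stopping times may be infinite; with $\zeta=\inf\{t\ge0: X_t=0\text{ or }\beta\}$ one sets $X_\infty:=\limsup_{t\to\zeta}X_t$, and the process is regarded as staying at an end point after reaching it. $\tau_z=\inf\{t\ge0:X_t=z\}$, $\tau_{(z,y)}=\inf\{t\ge0:X_t\notin(z,y)\}$, with $\tau_{(0,z)}=\lim_{a\to0}\tau_{(a,z)}$ and $\tau_{(z,\beta)}=\lim_{b\to\beta}\tau_{(z,b)}$. The game (for fixed $x$). Payoff: $A((a,b),c)=\mathbb E_x\{(X_{\tau_{(a,b)}}-c)^2\}$. Pure strategies of the sup-player: $(a,b)\in[0,x]\times[x,B_x]$; pure strategies of the inf-player: $c\in[0,M_x]$. If $\beta<\infty$, $M_x=B_x=\beta$. If $\beta=\infty$: let $u^*$ be the greatest point of $[x,\beta)$ maximizing $u/S(u)$ over $u\in[x,\beta)$ and $M_x:=2\frac{u^*}{S(u^* )}S(x)$; let $\bar b=3M_x$ if $M_x\ge x$ and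 $\bar b=3x$ if $M_x<x$; let $\varepsilon:=\frac{(\bar b-M_x)^2-\max(x^2,M_x^2)}{S(\bar b)}>0$; and let $B_x<\infty$ be a number such that $\frac{(b-c)^2-(a-c)^2}{S(b)-S(a)}<\varepsilon$ for all $b>B_x$, $a\in[0,x]$, $c\in[0,M_x]$ (such a number exists). Mixed strategies: for the sup-player, the mixed strategy $y=\xi_p(a_1,b_1)+(1-\xi_p)(a_2,b_2)$ uses $(a_1,b_1)$ with probability $p$ and $(a_2,b_2)$ with probability $1-p$ (where $\mathbb P(\xi_p=1)=p=1-\mathbb P(\xi_p=0)$), and $A(y,c)=pA((a_1,b_1),c)+(1-p)A((a_2,b_2),c)$. The game has value $V$ if $V=\sup_y\inf_cA(y,c)=\inf_c\sup_yA(y,c)$ over strategies (mixed ones allowed). Strategies $y^*,c^*$ are optimal if $A(y^*,c)\ge V$ for all $c$ and $A(y,c^* )\le V$ for all $y$. A pure strategy $(a,b)$ of the sup-player is essential if $A((a,b),c^* )=V$, where $c^*$ is an optimal strategy of the inf-player. $z_c$ denotes the greatest point $z\in(0,\beta)$ maximizing $\frac{z^2-2cz}{S(z)}$. *)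

theory Defs
  imports "HOL-Probability.Probability"
begin

section \<open>Linear diffusions on an interval with left end point 0\<close>

text \<open>Conventions. The right end point \<open>\<beta>\<close> is an extended real, so that \<open>\<beta> = \<infinity>\<close> is allowed. A path
  \<open>t \<mapsto> X t \<omega>\<close>, \<open>t \<ge> 0\<close>, takes its values in the closed interval \<open>[0, \<beta>]\<close> of the extended reals and
  stays at an end point once it has reached it. Random times are \<open>ennreal\<close>-valued, because they may
  be infinite. The laws \<open>P x\<close> are only used for starting points in the open interval, which leaves
  open how (and whether) the process can be started from an end point.\<close>

definition state_interior :: "ereal \<Rightarrow> real set" where
  "state_interior \<beta> = {y. 0 < y \<and> ereal y < \<beta>}"

definition path_space :: "(real \<Rightarrow> ereal) measure" where
  "path_space = (\<Pi>\<^sub>M t\<in>{0..}. borel)"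

definition sample_path :: "(real \<Rightarrow> 'w \<Rightarrow> ereal) \<Rightarrow> 'w \<Rightarrow> real \<Rightarrow> ereal" where
  "sample_path X \<omega> = (\<lambda>t\<in>{0..}. X t \<omega>)"

text \<open>In the next two definitions the infimum of the empty set is \<open>\<infinity>\<close>.\<close>

definition hit_time :: "(real \<Rightarrow> 'w \<Rightarrow> ereal) \<Rightarrow> ereal \<Rightarrow> 'w \<Rightarrow> ennreal" where
  "hit_time X z \<omega> = (INF t\<in>{t. 0 \<le> t \<and> X t \<omega> = z}. ennreal t)"

definition first_exit :: "(real \<Rightarrow> 'w \<Rightarrow> ereal) \<Rightarrow> ereal \<Rightarrow> ereal \<Rightarrow> 'w \<Rightarrow> ennreal" where
  "first_exit X a b \<omega> = (INF t\<in>{t. 0 \<le> t \<and> X t \<omega> \<notin> {a<..<b}}. ennreal t)"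

text \<open>The exit times of intervals that touch an end point of the state space are limits.\<close>

definition exit_time :: "(real \<Rightarrow> 'w \<Rightarrow> ereal) \<Rightarrow> ereal \<Rightarrow> ereal \<Rightarrow> ereal \<Rightarrow> 'w \<Rightarrow> ennreal" where
  "exit_time X \<beta> a b \<omega> =
    (let \<tau> = (\<lambda>b'. if a = 0 then Lim (at_right 0) (\<lambda>a'. first_exit X a' b' \<omega>)
                   else first_exit X a b' \<omega>)
     in if b = \<beta> then Lim (at_left \<beta>) \<tau> else \<tau> b)"

definition lifetime :: "(real \<Rightarrow> 'w \<Rightarrow> ereal) \<Rightarrow> ereal \<Rightarrow> 'w \<Rightarrow> ennreal" where
  "lifetime X \<beta> \<omega> = (INF t\<in>{t. 0 \<le> t \<and> (X t \<omega> = 0 \<or> X t \<omega> = \<beta>)}. ennreal t)"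

definition terminal_value :: "(real \<Rightarrow> 'w \<Rightarrow> ereal) \<Rightarrow> ereal \<Rightarrow> 'w \<Rightarrow> ereal" where
  "terminal_value X \<beta> \<omega> =
    Limsup (if lifetime X \<beta> \<omega> = \<infinity> then at_top else at_left (enn2real (lifetime X \<beta> \<omega>)))
      (\<lambda>t. X t \<omega>)"

definition value_at ::
    "(real \<Rightarrow> 'w \<Rightarrow> ereal) \<Rightarrow> ereal \<Rightarrow> ('w \<Rightarrow> ennreal) \<Rightarrow> 'w \<Rightarrow> ereal" where
  "value_at X \<beta> T \<omega> =
    (if T \<omega> = \<infinity> then terminal_value X \<beta> \<omega> else X (enn2real (T \<omega>)) \<omega>)"

text \<open>Green function of the interval \<open>(a, b)\<close> with respect to the scale function \<open>S\<close>. The speed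
  measure \<open>m\<close> is normalised by \<open>E\<^sub>x \<tau>\<^bsub>(a,b)\<^esub> = \<integral> green S a b x y m(dy)\<close>.\<close>

definition green :: "(real \<Rightarrow> real) \<Rightarrow> real \<Rightarrow> real \<Rightarrow> real \<Rightarrow> real \<Rightarrow> real" where
  "green S a b x y = (S (min x y) - S a) * (S b - S (max x y)) / (S b - S a)"

text \<open>In \<open>strong_Markov\<close> the time \<open>T\<close> is an arbitrary stopping time and \<open>G\<close> an arbitrary event of its
  past; the assumption says that on \<open>{T < \<zeta>}\<close> the conditional law of the path after \<open>T\<close> given this
  past is the law of the process started from the position at time \<open>T\<close>. From \<open>\<zeta>\<close> on the path is constant by
  \<open>absorbed\<close>. Together, \<open>range\<close> and \<open>absorbed\<close> say that the process does not die in the open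
  interval. The speed measure is continuous in the sense that it has no atoms.\<close>

locale linear_diffusion = filtration "space M" F
  for M :: "'w measure" and F :: "ennreal \<Rightarrow> 'w measure" +
  fixes P :: "real \<Rightarrow> 'w measure"
    and X :: "real \<Rightarrow> 'w \<Rightarrow> ereal"
    and \<beta> :: ereal
    and S :: "real \<Rightarrow> real"
    and m :: "real measure"
  assumes pos_right_end: "0 < \<beta>"
    and sub_M: "\<And>t. sets (F t) \<subseteq> sets M"
    and adapted: "\<And>t. 0 \<le> t \<Longrightarrow> X t \<in> F (ennreal t) \<rightarrow>\<^sub>M borel"
    and prob: "\<And>y. y \<in> state_interior \<beta> \<Longrightarrow> prob_space (P y)"
    and sets_P: "\<And>y. y \<in> state_interior \<beta> \<Longrightarrow> sets (P y) = sets M"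
    and kernel: "(\<lambda>y. distr (P y) path_space (sample_path X))
        \<in> restrict_space borel (state_interior \<beta>) \<rightarrow>\<^sub>M prob_algebra path_space"
    and start: "\<And>y. y \<in> state_interior \<beta> \<Longrightarrow> AE \<omega> in P y. X 0 \<omega> = ereal y"
    and range: "\<And>t \<omega>. \<omega> \<in> space M \<Longrightarrow> 0 \<le> t \<Longrightarrow> X t \<omega> \<in> {0..\<beta>}"
    and cont_paths: "\<And>\<omega>. \<omega> \<in> space M \<Longrightarrow> continuous_on {0..} (\<lambda>t. X t \<omega>)"
    and absorbed: "\<And>s t \<omega>. \<omega> \<in> space M \<Longrightarrow> 0 \<le> s \<Longrightarrow> s \<le> t \<Longrightarrow> X s \<omega> \<in> {0, \<beta>} \<Longrightarrow> X t \<omega> = X s \<omega>"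
    and strong_Markov: "\<And>y T G D B.
        \<lbrakk>y \<in> state_interior \<beta>; stopping_time F T; G \<in> sets (pre_sigma T); B \<in> sets path_space;
         D = {\<omega> \<in> G. T \<omega> < \<infinity> \<and> 0 < X (enn2real (T \<omega>)) \<omega> \<and> X (enn2real (T \<omega>)) \<omega> < \<beta>}\<rbrakk> \<Longrightarrow>
        emeasure (P y) {\<omega> \<in> D. sample_path (\<lambda>t. X (enn2real (T \<omega>) + t)) \<omega> \<in> B} =
        (\<integral>\<^sup>+\<omega>. indicator D \<omega> *
           emeasure (distr (P (real_of_ereal (X (enn2real (T \<omega>)) \<omega>))) path_space (sample_path X)) B \<partial>P y)"
    and regular: "\<And>y z. y \<in> state_interior \<beta> \<Longrightarrow> z \<in> state_interior \<beta> \<Longrightarrow>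
        0 < measure (P y) {\<omega> \<in> space M. hit_time X z \<omega> < \<infinity>}"
    and scale_mono: "strict_mono_on (state_interior \<beta>) S"
    and scale_cont: "continuous_on (state_interior \<beta>) S"
    and scale_hit: "\<And>a y b. 0 < a \<Longrightarrow> a < y \<Longrightarrow> y < b \<Longrightarrow> ereal b < \<beta> \<Longrightarrow>
        measure (P y) {\<omega> \<in> space M. hit_time X b \<omega> < hit_time X a \<omega>} = (S y - S a) / (S b - S a)"
    and sets_speed: "sets m = sets borel"
    and speed_finite: "\<And>a b. 0 < a \<Longrightarrow> a < b \<Longrightarrow> ereal b < \<beta> \<Longrightarrow> emeasure m {a..b} < \<infinity>"
    and speed_exit: "\<And>a y b. 0 < a \<Longrightarrow> a < y \<Longrightarrow> y < b \<Longrightarrow> ereal b < \<beta> \<Longrightarrow>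
        (\<integral>\<^sup>+\<omega>. first_exit X a b \<omega> \<partial>P y) = (\<integral>\<^sup>+z\<in>{a<..<b}. ennreal (green S a b y z) \<partial>m)"
    and speed_cont: "\<And>z. z \<in> state_interior \<beta> \<Longrightarrow> emeasure m {z} = 0"

text \<open>The filter of a real variable tending to \<open>\<beta>\<close> from inside the state space.\<close>

definition at_right_end :: "ereal \<Rightarrow> real filter" where
  "at_right_end \<beta> = (if \<beta> = \<infinity> then at_top else at_left (real_of_ereal \<beta>))"

definition scale_ext :: "(real \<Rightarrow> real) \<Rightarrow> real \<Rightarrow> real" where
  "scale_ext S a = (if a = 0 then Lim (at_right 0) S else S a)"

section \<open>The game\<close>

definition is_greatest_arg_max :: "(real \<Rightarrow> real) \<Rightarrow> real set \<Rightarrow> real \<Rightarrow> bool" where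
  "is_greatest_arg_max f D z \<longleftrightarrow>
    is_arg_max f (\<lambda>w. w \<in> D) z \<and> (\<forall>w. is_arg_max f (\<lambda>w. w \<in> D) w \<longrightarrow> w \<le> z)"

definition greatest_arg_max :: "(real \<Rightarrow> real) \<Rightarrow> real set \<Rightarrow> real" where
  "greatest_arg_max f D = (THE z. is_greatest_arg_max f D z)"

definition z_fun :: "(real \<Rightarrow> real) \<Rightarrow> real \<Rightarrow> real \<Rightarrow> real" where
  "z_fun S c z = (z\<^sup>2 - 2 * c * z) / S z"

definition z_of :: "ereal \<Rightarrow> (real \<Rightarrow> real) \<Rightarrow> real \<Rightarrow> real" where
  "z_of \<beta> S c = greatest_arg_max (z_fun S c) (state_interior \<beta>)"

definition payoff ::
    "(real \<Rightarrow> 'w measure) \<Rightarrow> (real \<Rightarrow> 'w \<Rightarrow> ereal) \<Rightarrow> ereal \<Rightarrow> real \<Rightarrow> real \<times> real \<Rightarrow> real \<Rightarrow> real" where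
  "payoff P X \<beta> x s c =
    (\<integral>\<omega>. (real_of_ereal (value_at X \<beta> (exit_time X \<beta> (fst s) (snd s)) \<omega>) - c)\<^sup>2 \<partial>P x)"

definition u_star :: "ereal \<Rightarrow> (real \<Rightarrow> real) \<Rightarrow> real \<Rightarrow> real" where
  "u_star \<beta> S x = greatest_arg_max (\<lambda>u. u / S u) {u. x \<le> u \<and> ereal u < \<beta>}"

definition M_bound :: "ereal \<Rightarrow> (real \<Rightarrow> real) \<Rightarrow> real \<Rightarrow> real" where
  "M_bound \<beta> S x =
    (if \<beta> < \<infinity> then real_of_ereal \<beta>
     else 2 * (u_star \<beta> S x / S (u_star \<beta> S x)) * S x)"

definition b_bar :: "ereal \<Rightarrow> (real \<Rightarrow> real) \<Rightarrow> real \<Rightarrow> real" where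
  "b_bar \<beta> S x = (if M_bound \<beta> S x \<ge> x then 3 * M_bound \<beta> S x else 3 * x)"

definition game_eps :: "ereal \<Rightarrow> (real \<Rightarrow> real) \<Rightarrow> real \<Rightarrow> real" where
  "game_eps \<beta> S x =
    ((b_bar \<beta> S x - M_bound \<beta> S x)\<^sup>2 - max (x\<^sup>2) ((M_bound \<beta> S x)\<^sup>2)) / S (b_bar \<beta> S x)"

text \<open>\<open>B\<close> is an admissible upper end of the range \<open>[x, B]\<close> of the strategies \<open>b\<close>. For \<open>\<beta> = \<infinity>\<close> it is
  any number that is large enough; \<open>x \<le> B\<close> is needed for \<open>[x, B]\<close> to be nonempty.\<close>

definition is_B_bound :: "ereal \<Rightarrow> (real \<Rightarrow> real) \<Rightarrow> real \<Rightarrow> real \<Rightarrow> bool" where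
  "is_B_bound \<beta> S x B \<longleftrightarrow>
    (if \<beta> < \<infinity> then B = real_of_ereal \<beta>
     else x \<le> B \<and>
       (\<forall>b>B. \<forall>a\<in>{0..x}. \<forall>c\<in>{0..M_bound \<beta> S x}.
          ((b - c)\<^sup>2 - (a - c)\<^sup>2) / (S b - scale_ext S a) < game_eps \<beta> S x))"

text \<open>Mixed strategies are discrete distributions on the set of pure strategies; this class
  contains the mixtures \<open>\<xi>\<^sub>p s + (1 - \<xi>\<^sub>p) s'\<close> of two pure strategies.\<close>

definition mixed :: "'s set \<Rightarrow> 's pmf set" where
  "mixed D = {y. set_pmf y \<subseteq> D}"

definition two_point :: "real \<Rightarrow> 's \<Rightarrow> 's \<Rightarrow> 's pmf" where
  "two_point p s s' = map_pmf (\<lambda>\<xi>. if \<xi> then s else s') (bernoulli_pmf p)"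

definition mixed_payoff :: "('s \<Rightarrow> 'c \<Rightarrow> real) \<Rightarrow> 's pmf \<Rightarrow> 'c pmf \<Rightarrow> real" where
  "mixed_payoff A y q = measure_pmf.expectation (pair_pmf y q) (\<lambda>(s, c). A s c)"

text \<open>Suprema and infima of payoffs are taken in the extended reals, where they always exist.\<close>

definition has_value :: "('s \<Rightarrow> 'c \<Rightarrow> real) \<Rightarrow> 's set \<Rightarrow> 'c set \<Rightarrow> real \<Rightarrow> bool" where
  "has_value A D C V \<longleftrightarrow>
    ereal V = (SUP y\<in>mixed D. INF q\<in>mixed C. ereal (mixed_payoff A y q)) \<and>
    ereal V = (INF q\<in>mixed C. SUP y\<in>mixed D. ereal (mixed_payoff A y q))"

definition optimal_sup :: "('s \<Rightarrow> 'c \<Rightarrow> real) \<Rightarrow> 's set \<Rightarrow> 'c set \<Rightarrow> real \<Rightarrow> 's pmf \<Rightarrow> bool" where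
  "optimal_sup A D C V y \<longleftrightarrow> y \<in> mixed D \<and> (\<forall>q\<in>mixed C. mixed_payoff A y q \<ge> V)"

definition optimal_inf :: "('s \<Rightarrow> 'c \<Rightarrow> real) \<Rightarrow> 's set \<Rightarrow> 'c set \<Rightarrow> real \<Rightarrow> 'c pmf \<Rightarrow> bool" where
  "optimal_inf A D C V q \<longleftrightarrow> q \<in> mixed C \<and> (\<forall>y\<in>mixed D. mixed_payoff A y q \<le> V)"

definition essential ::
    "('s \<Rightarrow> 'c \<Rightarrow> real) \<Rightarrow> 's set \<Rightarrow> 'c set \<Rightarrow> real \<Rightarrow> 'c \<Rightarrow> 's \<Rightarrow> bool" where
  "essential A D C V c s \<longleftrightarrow>
    optimal_inf A D C V (return_pmf c) \<and> s \<in> D \<and> A s c = V"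

end

theory Submission
  imports Defs
begin

text \<open>Write \<open>w\<close> for the probability that the exit from \<open>(a, b)\<close> takes place at \<open>b\<close>. The payoff is
  \<open>c\<^sup>2 - 2 c E + Q\<close>, where \<open>E = (1 - w) a + w b\<close> and \<open>Q = (1 - w) a\<^sup>2 + w b\<^sup>2\<close> are the first two
  moments of the stopped position; when \<open>a = 0\<close> this uses that \<open>X\<close> tends to \<open>0\<close> almost surely, because from a
  small level \<open>a\<close> the probability of ever returning to \<open>y\<close> is \<open>S a / S y\<close>. By compactness and connectedness some \<open>c\<close> has best
  replies of means \<open>E\<^sub>1 \<ge> c \<ge> E\<^sub>2\<close>. The value exceeds \<open>c\<^sup>2\<close>, and this forces every best reply with mean
  below \<open>2 c\<close> to be of the form \<open>(0, b)\<close>, where \<open>b\<close> maximizes \<open>(z\<^sup>2 - 2 c z) / S z\<close> over the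
  whole state space. Passing to the greatest maximizer \<open>z\<close> only lowers the mean, so some mixture of the
  first best reply with \<open>(0, z)\<close> has mean exactly \<open>c\<close>. Against \<open>c'\<close> this mixture earns
  \<open>V + (c' - c)\<^sup>2\<close>, so that \<open>c\<close> is the unique minimizer.\<close>

section \<open>Path properties and measurability\<close>

text \<open>The excess of the payoff over \<open>c\<^sup>2\<close> is
  \<open>(1 - w) * (a * (a - 2 * c)) + w * (b * (b - 2 * c))\<close>. So only exits beyond
  \<open>2 * c\<close> gain, and this is why \<open>2 * c\<close> rather than \<open>c\<close> is
  the threshold that separates the two kinds of best reply. That the value exceeds
  \<open>c\<^sup>2\<close> is immediate for infinite \<beta>:
  \<open>b = 3 * M_bound \<beta> S x\<close> lies beyond \<open>2 * c\<close> for every admissible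
  \<open>c\<close>. For finite \<beta> it could fail when \<open>2 * c\<close> is at least \<beta>,
  but then every best reply has mean 0, which excludes one with mean at least \<open>c > 0\<close>.
  The factor 2 in \<open>M_bound\<close> belongs to infinite \<beta>: there \<open>M_bound\<close>
  is twice the largest mean of a strategy \<open>(0, u)\<close>, so at the right end of the interval
  of \<open>c\<close> every best reply has mean at most \<open>c\<close>. The obstacle to
  compactness is the boundary of the strategy rectangle. At \<open>b = \<beta>\<close> the scale is
  infinite, so \<open>1 / S b\<close> is used, extended by 0. At \<open>(x, x)\<close> the exit
  probability has no limit, but the two moments do.\<close>

lemma SUP_eq_SUP_dense:
  fixes f :: "real \<Rightarrow> ereal"
  assumes "continuous_on S f" "C \<subseteq> S" "closed S" "S \<subseteq> closure C"
  shows "(SUP t\<in>S. f t) = (SUP t\<in>C. f t)"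
proof (rule antisym)
  have "closure C \<subseteq> S"
    using assms(2,3) by (rule closure_minimal)
  then have "continuous_on (closure C) f"
    using assms(1) by (rule continuous_on_subset[rotated])
  then have "f ` closure C \<subseteq> {..(SUP t\<in>C. f t)}"
    by (rule image_closure_subset) (auto intro: SUP_upper)
  then show "(SUP t\<in>S. f t) \<le> (SUP t\<in>C. f t)"
    using assms(4) by (intro SUP_least) auto
  show "(SUP t\<in>C. f t) \<le> (SUP t\<in>S. f t)"
    using assms(2) by (rule SUP_subset_mono) simp
qed

lemma INF_eq_INF_dense:
  fixes f :: "real \<Rightarrow> ereal"
  assumes "continuous_on S f" "C \<subseteq> S" "closed S" "S \<subseteq> closure C"
  shows "(INF t\<in>S. f t) = (INF t\<in>C. f t)"
proof (rule antisym)
  have "closure C \<subseteq> S"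
    using assms(2,3) by (rule closure_minimal)
  then have "continuous_on (closure C) f"
    using assms(1) by (rule continuous_on_subset[rotated])
  then have "f ` closure C \<subseteq> {(INF t\<in>C. f t)..}"
    by (rule image_closure_subset) (auto intro: INF_lower)
  then show "(INF t\<in>C. f t) \<le> (INF t\<in>S. f t)"
    using assms(4) by (intro INF_greatest) auto
  show "(INF t\<in>S. f t) \<le> (INF t\<in>C. f t)"
    using assms(2) by (rule INF_superset_mono) simp
qed

text \<open>Together with the next lemma this supplies the countable sets of times over which
  suprema and infima of a continuous path can be taken, as measurability requires.\<close>

lemma closure_rats_atLeast: "{a..} \<subseteq> closure (\<rat> \<inter> {a::real..})"
proof -
  have "{a<..} \<inter> closure \<rat> \<subseteq> closure ({a<..} \<inter> \<rat>)"
    by (intro open_Int_closure_subset) auto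
  then have "closure {a<..} \<subseteq> closure ({a<..} \<inter> \<rat>)"
    by (intro closure_minimal) (auto simp: Rats_closure_real)
  also have "\<dots> \<subseteq> closure (\<rat> \<inter> {a..})"
    by (intro closure_mono) auto
  finally show ?thesis by simp
qed

text \<open>If \<open>a = b\<close> is irrational, the interval contains no rational; adding the end
  point keeps the countable set dense in this case too.\<close>

lemma closure_rats_Icc: "{a..b} \<subseteq> closure (insert b (\<rat> \<inter> {a::real..b}))"
proof (cases "a < b")
  case True
  have "{a<..<b} \<inter> closure \<rat> \<subseteq> closure ({a<..<b} \<inter> \<rat>)"
    by (intro open_Int_closure_subset) auto
  then have "closure {a<..<b} \<subseteq> closure ({a<..<b} \<inter> \<rat>)"
    by (intro closure_minimal) (auto simp: Rats_closure_real)
  also have "\<dots> \<subseteq> closure (insert b (\<rat> \<inter> {a..b}))"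
    by (intro closure_mono) auto
  finally show ?thesis using True by simp
next
  case False
  then have "{a..b} \<subseteq> {b}" by auto
  then show ?thesis using closure_subset by fastforce
qed

lemma INF_ennreal_attained:
  assumes "closed Z" "Z \<subseteq> {0..}" "Z \<noteq> {}"
  obtains t where "t \<in> Z" "\<And>s. s \<in> Z \<Longrightarrow> t \<le> s" "(INF s\<in>Z. ennreal s) = ennreal t"
proof
  have bdd: "bdd_below Z" using assms(2) by (auto intro: bdd_belowI)
  show Inf: "Inf Z \<in> Z" using closed_contains_Inf[OF assms(3) bdd assms(1)] .
  show le: "Inf Z \<le> s" if "s \<in> Z" for s using cInf_lower[OF that bdd] .
  show "(INF s\<in>Z. ennreal s) = ennreal (Inf Z)"
    by (intro antisym INF_lower INF_greatest Inf ennreal_leI le)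
qed

text \<open>Closedness turns the infimum into a minimum, so that \<open>\<le>\<close>, and not
  merely \<open><\<close>, is tested by a single witness.\<close>

lemma INF_ennreal_le_iff:
  assumes "closed Z" "Z \<subseteq> {0..}" "0 \<le> r"
  shows "(INF s\<in>Z. ennreal s) \<le> ennreal r \<longleftrightarrow> (\<exists>s\<in>Z. s \<le> r)"
proof (cases "Z = {}")
  case True
  then show ?thesis by (simp add: top_unique)
next
  case False
  from INF_ennreal_attained[OF assms(1,2) this] obtain t where
    "t \<in> Z" "\<And>s. s \<in> Z \<Longrightarrow> t \<le> s" "(INF s\<in>Z. ennreal s) = ennreal t" by blast
  then show ?thesis using assms by (auto simp: ennreal_le_iff intro: order_trans)
qed

section \<open>Hitting and exit times of continuous paths\<close>

context linear_diffusion
begin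

lemma closed_times:
  assumes "\<omega> \<in> space M" "closed A"
  shows "closed {t. 0 \<le> t \<and> X t \<omega> \<in> A}"
proof -
  have "closed ({0..} \<inter> (\<lambda>t. X t \<omega>) -` A)"
    using continuous_closed_preimage[OF cont_paths[OF assms(1)] _ assms(2)] by auto
  also have "{0..} \<inter> (\<lambda>t. X t \<omega>) -` A = {t. 0 \<le> t \<and> X t \<omega> \<in> A}" by auto
  finally show ?thesis .
qed

lemma closed_hitting_times: "\<omega> \<in> space M \<Longrightarrow> closed {t. 0 \<le> t \<and> X t \<omega> = z}"
  using closed_times[of \<omega> "{z}"] by simp

lemma closed_exit_times: "\<omega> \<in> space M \<Longrightarrow> closed {t. 0 \<le> t \<and> X t \<omega> \<notin> {a<..<b}}"
  using closed_times[of \<omega> "- {a<..<b}"] by (simp only: Compl_iff closed_Compl open_greaterThanLessThan)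

lemma hit_time_le_iff:
  assumes "\<omega> \<in> space M" "0 \<le> r"
  shows "hit_time X z \<omega> \<le> ennreal r \<longleftrightarrow> (\<exists>s\<in>{0..r}. X s \<omega> = z)"
  unfolding hit_time_def
  by (subst INF_ennreal_le_iff[OF closed_hitting_times[OF assms(1)] _ assms(2)]) auto

lemma first_exit_le_iff:
  assumes "\<omega> \<in> space M" "0 \<le> r"
  shows "first_exit X a b \<omega> \<le> ennreal r \<longleftrightarrow> (\<exists>s\<in>{0..r}. X s \<omega> \<notin> {a<..<b})"
  unfolding first_exit_def
  by (subst INF_ennreal_le_iff[OF closed_exit_times[OF assms(1)] _ assms(2)]) auto

lemma hit_time_finite_iff: "hit_time X z \<omega> < \<infinity> \<longleftrightarrow> (\<exists>s\<ge>0. X s \<omega> = z)"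
  unfolding hit_time_def INF_less_iff by auto

lemma first_exit_finite_iff: "first_exit X a b \<omega> < \<infinity> \<longleftrightarrow> (\<exists>s\<ge>0. X s \<omega> \<notin> {a<..<b})"
  unfolding first_exit_def INF_less_iff by auto

lemma hit_time_attained:
  assumes "\<omega> \<in> space M" "hit_time X z \<omega> < \<infinity>"
  obtains t where "0 \<le> t" "hit_time X z \<omega> = ennreal t" "X t \<omega> = z"
proof -
  have "{t. 0 \<le> t \<and> X t \<omega> = z} \<noteq> {}"
    using assms(2) unfolding hit_time_finite_iff by auto
  from INF_ennreal_attained[OF closed_hitting_times[OF assms(1)] _ this] that
  show ?thesis unfolding hit_time_def by (metis (mono_tags, lifting) atLeast_iff mem_Collect_eq subsetI)
qed

lemma path_IVT:
  assumes "\<omega> \<in> space M" "0 \<le> s" "0 \<le> t"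
    and "X s \<omega> \<le> z" "z \<le> X t \<omega>"
  shows "\<exists>u. min s t \<le> u \<and> u \<le> max s t \<and> X u \<omega> = z"
proof (cases "s \<le> t")
  case True
  then show ?thesis
    using IVT'[of "\<lambda>t. X t \<omega>" s z t] assms
      continuous_on_subset[OF cont_paths[OF assms(1)], of "{s..t}"] by auto
next
  case False
  then show ?thesis
    using IVT2'[of "\<lambda>t. X t \<omega>" s z t] assms
      continuous_on_subset[OF cont_paths[OF assms(1)], of "{t..s}"] by auto
qed

lemma first_exit_attained:
  assumes "\<omega> \<in> space M" "first_exit X a b \<omega> < \<infinity>"
  obtains t where "0 \<le> t" "first_exit X a b \<omega> = ennreal t" "X t \<omega> \<notin> {a<..<b}"
    "\<And>s. 0 \<le> s \<Longrightarrow> s < t \<Longrightarrow> X s \<omega> \<in> {a<..<b}"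
proof -
  let ?Z = "{t. 0 \<le> t \<and> X t \<omega> \<notin> {a<..<b}}"
  have "?Z \<noteq> {}"
    using assms(2) unfolding first_exit_finite_iff by auto
  moreover have "?Z \<subseteq> {0..}" by auto
  ultimately obtain t where t: "t \<in> ?Z" "\<And>s. s \<in> ?Z \<Longrightarrow> t \<le> s" "(INF s\<in>?Z. ennreal s) = ennreal t"
    using INF_ennreal_attained[OF closed_exit_times[OF assms(1)]] by blast
  show ?thesis
  proof (rule that[of t])
    show "0 \<le> t" "X t \<omega> \<notin> {a<..<b}" using t(1) by auto
    show "first_exit X a b \<omega> = ennreal t" using t(3) by (simp only: first_exit_def)
    show "X s \<omega> \<in> {a<..<b}" if "0 \<le> s" "s < t" for s
      using t(2)[of s] that by force
  qed
qed

text \<open>A path that is beyond an end point at the exit time would have crossed that end point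
  earlier, by the intermediate value theorem, and so would have left the interval earlier.\<close>

lemma first_exit_endpoint:
  assumes "\<omega> \<in> space M" "first_exit X a b \<omega> < \<infinity>" "X 0 \<omega> \<in> {a<..<b}"
  obtains t where "0 \<le> t" "first_exit X a b \<omega> = ennreal t" "X t \<omega> \<in> {a, b}"
    "\<And>s. 0 \<le> s \<Longrightarrow> s < t \<Longrightarrow> X s \<omega> \<in> {a<..<b}"
proof -
  from first_exit_attained[OF assms(1,2)] obtain t where
    t: "0 \<le> t" "first_exit X a b \<omega> = ennreal t" "X t \<omega> \<notin> {a<..<b}"
    "\<And>s. 0 \<le> s \<Longrightarrow> s < t \<Longrightarrow> X s \<omega> \<in> {a<..<b}" by blast
  have "X t \<omega> \<in> {a, b}"
  proof (rule ccontr)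
    assume "X t \<omega> \<notin> {a, b}"
    with t(3) have "X t \<omega> < a \<or> b < X t \<omega>" by auto
    then obtain z u where u: "0 \<le> u" "u \<le> t" "X u \<omega> = z" "z \<in> {a, b}"
      using path_IVT[OF assms(1) t(1), of 0 a] path_IVT[OF assms(1) _ t(1), of 0 b] assms(3) t(1)
      by fastforce
    then have "u < t" using \<open>X t \<omega> \<notin> {a, b}\<close> by (cases "u = t") auto
    with t(4) u show False by fastforce
  qed
  with t that show ?thesis by blast
qed

lemma first_exit_mono:
  "a' \<le> a \<Longrightarrow> b \<le> b' \<Longrightarrow> first_exit X a b \<omega> \<le> first_exit X a' b' \<omega>"
  unfolding first_exit_def by (intro INF_superset_mono) auto

lemma first_exit_le_lifetime:
  "0 \<le> a \<Longrightarrow> b \<le> \<beta> \<Longrightarrow> first_exit X a b \<omega> \<le> lifetime X \<beta> \<omega>"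
  unfolding first_exit_def lifetime_def by (intro INF_superset_mono) auto

lemma ennreal_less_cases:
  fixes l :: ennreal assumes "l < u"
  obtains r where "0 \<le> r" "l = ennreal r"
  using assms by (cases l) auto

text \<open>If \<open>(0, b)\<close> has not been left by time \<open>r\<close>, the path has a
  positive minimum on \<open>[0, r]\<close>, and levels \<open>a'\<close> below this minimum cause
  no exit by time \<open>r\<close>. The upper bound is monotonicity in the interval.\<close>

lemma first_exit_tendsto_left:
  assumes "\<omega> \<in> space M"
  shows "((\<lambda>a'. first_exit X a' b \<omega>) \<longlongrightarrow> first_exit X 0 b \<omega>) (at_right 0)"
proof (rule order_tendstoI)
  fix l assume l: "l < first_exit X 0 b \<omega>"
  then obtain r where r: "0 \<le> r" "l = ennreal r" by (rule ennreal_less_cases)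
  have inside: "X s \<omega> \<in> {0<..<b}" if "s \<in> {0..r}" for s
    using first_exit_le_iff[OF assms r(1), of 0 b] l r that by (auto simp: not_le[symmetric])
  obtain s0 where s0: "s0 \<in> {0..r}" "\<And>s. s \<in> {0..r} \<Longrightarrow> X s0 \<omega> \<le> X s \<omega>"
    using continuous_attains_inf[OF compact_Icc, of 0 r "\<lambda>t. X t \<omega>"] r
      continuous_on_subset[OF cont_paths[OF assms], of "{0..r}"] by auto
  have "l < first_exit X a' b \<omega>" if "0 < a'" "a' < X s0 \<omega>" for a'
  proof -
    have "X s \<omega> \<in> {a'<..<b}" if "s \<in> {0..r}" for s
      using s0(2)[OF that] inside[OF that] \<open>a' < X s0 \<omega>\<close> by auto
    then show ?thesis
      using first_exit_le_iff[OF assms r(1), of a' b] r by (auto simp: not_le[symmetric])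
  qed
  then show "\<forall>\<^sub>F a' in at_right 0. l < first_exit X a' b \<omega>"
    using inside[OF s0(1)] by (intro eventually_at_rightI[of 0 "X s0 \<omega>"]) auto
next
  fix u assume u: "first_exit X 0 b \<omega> < u"
  have "first_exit X a' b \<omega> < u" if "0 < a'" for a'
    using that by (intro le_less_trans[OF first_exit_mono u]) auto
  then show "\<forall>\<^sub>F a' in at_right 0. first_exit X a' b \<omega> < u"
    by (intro eventually_at_rightI[of 0 1]) auto
qed

lemma first_exit_tendsto_right:
  assumes "\<omega> \<in> space M"
  shows "((\<lambda>b'. first_exit X a b' \<omega>) \<longlongrightarrow> first_exit X a \<beta> \<omega>) (at_left \<beta>)"
proof (rule order_tendstoI)
  fix l assume l: "l < first_exit X a \<beta> \<omega>"
  then obtain r where r: "0 \<le> r" "l = ennreal r" by (rule ennreal_less_cases)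
  have inside: "X s \<omega> \<in> {a<..<\<beta>}" if "s \<in> {0..r}" for s
    using first_exit_le_iff[OF assms r(1), of a \<beta>] l r that by (auto simp: not_le[symmetric])
  obtain s0 where s0: "s0 \<in> {0..r}" "\<And>s. s \<in> {0..r} \<Longrightarrow> X s \<omega> \<le> X s0 \<omega>"
    using continuous_attains_sup[OF compact_Icc, of 0 r "\<lambda>t. X t \<omega>"] r
      continuous_on_subset[OF cont_paths[OF assms], of "{0..r}"] by auto
  have "l < first_exit X a b' \<omega>" if "X s0 \<omega> < b'" for b'
  proof -
    have "X s \<omega> \<in> {a<..<b'}" if "s \<in> {0..r}" for s
      using s0(2)[OF that] inside[OF that] \<open>X s0 \<omega> < b'\<close> by auto
    then show ?thesis
      using first_exit_le_iff[OF assms r(1), of a b'] r by (auto simp: not_le[symmetric])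
  qed
  then show "\<forall>\<^sub>F b' in at_left \<beta>. l < first_exit X a b' \<omega>"
    using inside[OF s0(1)] by (intro eventually_at_leftI[of "X s0 \<omega>" \<beta>]) auto
next
  fix u assume u: "first_exit X a \<beta> \<omega> < u"
  have "first_exit X a b' \<omega> < u" if "b' < \<beta>" for b'
    using that by (intro le_less_trans[OF first_exit_mono u]) auto
  then show "\<forall>\<^sub>F b' in at_left \<beta>. first_exit X a b' \<omega> < u"
    using pos_right_end by (intro eventually_at_leftI[of 0 \<beta>]) auto
qed

text \<open>Paths are continuous up to the end points, so the iterated limits in
  \<open>exit_time\<close> (first in \<open>a'\<close>, then in \<open>b'\<close>) are just exit
  times of the limiting interval.\<close>

lemma exit_time_eq_first_exit:
  assumes "\<omega> \<in> space M"
  shows "exit_time X \<beta> a b \<omega> = first_exit X a b \<omega>"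
proof -
  have 0: "Lim (at_right 0) (\<lambda>a'. first_exit X a' b' \<omega>) = first_exit X 0 b' \<omega>" for b'
    by (intro tendsto_Lim first_exit_tendsto_left assms)
      (auto simp: trivial_limit_def eventually_at_right[of 0 "1::ereal"] dest: dense)
  have 1: "Lim (at_left \<beta>) (\<lambda>b'. first_exit X a b' \<omega>) = first_exit X a \<beta> \<omega>"
    using pos_right_end
    by (intro tendsto_Lim first_exit_tendsto_right assms)
      (auto simp: trivial_limit_def eventually_at_left dest: dense)
  show ?thesis
    unfolding exit_time_def Let_def using 0 1 by auto
qed

text \<open>Expresses the stopped position by hitting times and a limit superior, all of which are
  measurable. If the interval is never left, the lifetime is infinite as well, so
  \<open>terminal_value\<close> is a limit superior at infinite time.\<close>

lemma value_at_first_exit: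
  assumes "\<omega> \<in> space M" "0 \<le> a" "b \<le> \<beta>"
  shows "value_at X \<beta> (first_exit X a b) \<omega> =
    (if X 0 \<omega> \<notin> {a<..<b} then X 0 \<omega>
     else if hit_time X a \<omega> = \<infinity> \<and> hit_time X b \<omega> = \<infinity> then Limsup at_top (\<lambda>t. X t \<omega>)
     else if hit_time X b \<omega> < hit_time X a \<omega> then b else a)"
proof (cases "X 0 \<omega> \<in> {a<..<b}")
  case False
  then have "first_exit X a b \<omega> \<le> ennreal 0"
    using first_exit_le_iff[OF assms(1), of 0 a b] by auto
  then show ?thesis using False by (simp add: value_at_def)
next
  case True
  show ?thesis
  proof (cases "first_exit X a b \<omega> = \<infinity>")
    case inf: True
    have inside: "X s \<omega> \<in> {a<..<b}" if "0 \<le> s" for s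
      using first_exit_le_iff[OF assms(1) that, of a b] inf that by (auto simp: top_unique)
    have "hit_time X a \<omega> = \<infinity>" "hit_time X b \<omega> = \<infinity>"
      using hit_time_finite_iff inside by (force simp: less_top)+
    moreover have "lifetime X \<beta> \<omega> = \<infinity>"
      using first_exit_le_lifetime[OF assms(2,3), of \<omega>] inf by (simp add: top_unique)
    ultimately show ?thesis
      using True inf by (simp add: value_at_def terminal_value_def)
  next
    case False
    then have "first_exit X a b \<omega> < \<infinity>" by (simp add: less_top)
    from first_exit_endpoint[OF assms(1) this True] obtain t where
      t: "0 \<le> t" "first_exit X a b \<omega> = ennreal t" "X t \<omega> \<in> {a, b}"
      "\<And>s. 0 \<le> s \<Longrightarrow> s < t \<Longrightarrow> X s \<omega> \<in> {a<..<b}" by blast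
    have val: "value_at X \<beta> (first_exit X a b) \<omega> = X t \<omega>"
      using t by (simp add: value_at_def)
    have hit: "hit_time X (X t \<omega>) \<omega> \<le> ennreal t"
      using hit_time_le_iff[OF assms(1) t(1)] t(1) by auto
    have "\<not> hit_time X z \<omega> \<le> ennreal t" if "z \<in> {a, b}" "z \<noteq> X t \<omega>" for z
    proof
      assume "hit_time X z \<omega> \<le> ennreal t"
      then obtain s where "s \<in> {0..t}" "X s \<omega> = z"
        using hit_time_le_iff[OF assms(1) t(1)] by auto
      then show False using t(4)[of s] that by (cases "s = t") auto
    qed
    then show ?thesis
      using hit True t(3) unfolding val
      by (smt (verit) insert_iff greaterThanLessThan_iff singletonD ennreal_less_top infinity_ennreal_def
          le_less_trans less_trans not_le order.asym order.strict_trans1 leD top.not_eq_extremum)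
  qed
qed

section \<open>Measurability of hitting times and of the stopped position\<close>

lemma X_measurable [measurable]: "0 \<le> t \<Longrightarrow> X t \<in> borel_measurable M"
  using adapted[of t] sub_M[of "ennreal t"] measurable_mono[of borel borel "F (ennreal t)" M] space_F
  by auto

text \<open>By the intermediate value theorem \<open>z\<close> is hit by time \<open>r\<close>
  exactly when it lies between the minimum and the maximum of the path on \<open>[0, r]\<close>, and
  both are extrema over countably many times. \<open>strong_Markov\<close> asks for a stopping time,
  so measurability alone would not do.\<close>

lemma hit_time_stopping: "stopping_time F (hit_time X z)"
proof
  fix t :: ennreal
  show "Measurable.pred (F t) (\<lambda>\<omega>. hit_time X z \<omega> \<le> t)"
  proof (cases t)
    case top
    then show ?thesis by simp
  next
    case (real r)
    let ?C = "insert r (\<rat> \<inter> {0..r})"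
    have X_F [measurable]: "X s \<in> borel_measurable (F (ennreal r))" if "s \<in> ?C" for s
    proof (rule subsetD[OF measurable_mono])
      show "X s \<in> F (ennreal s) \<rightarrow>\<^sub>M borel" using adapted that real by auto
      show "sets (F (ennreal s)) \<subseteq> sets (F (ennreal r))"
        using that by (intro sets_F_mono ennreal_leI) auto
    qed (auto simp: space_F)
    have "countable ?C" by (auto intro: countable_Int1 countable_rat)
    then have meas: "(\<lambda>\<omega>. INF s\<in>?C. X s \<omega>) \<in> borel_measurable (F (ennreal r))"
      "(\<lambda>\<omega>. SUP s\<in>?C. X s \<omega>) \<in> borel_measurable (F (ennreal r))"
      using X_F by (auto intro!: borel_measurable_INF borel_measurable_SUP)
    have iff: "hit_time X z \<omega> \<le> t \<longleftrightarrow> (INF s\<in>?C. X s \<omega>) \<le> z \<and> z \<le> (SUP s\<in>?C. X s \<omega>)"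
      if "\<omega> \<in> space (F (ennreal r))" for \<omega>
    proof -
      have \<omega>: "\<omega> \<in> space M" using that by (simp add: space_F)
      have cont: "continuous_on {0..r} (\<lambda>s. X s \<omega>)"
        by (rule continuous_on_subset[OF cont_paths[OF \<omega>]]) auto
      have C: "?C \<subseteq> {0..r}" using real by auto
      note INF = INF_eq_INF_dense[OF cont C closed_atLeastAtMost closure_rats_Icc]
      note SUP = SUP_eq_SUP_dense[OF cont C closed_atLeastAtMost closure_rats_Icc]
      obtain s0 s1 where s: "s0 \<in> {0..r}" "\<And>s. s \<in> {0..r} \<Longrightarrow> X s0 \<omega> \<le> X s \<omega>"
        "s1 \<in> {0..r}" "\<And>s. s \<in> {0..r} \<Longrightarrow> X s \<omega> \<le> X s1 \<omega>"
        using continuous_attains_inf[OF compact_Icc _ cont]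
          continuous_attains_sup[OF compact_Icc _ cont] real by (metis atLeastatMost_empty_iff2)
      have "(INF s\<in>{0..r}. X s \<omega>) = X s0 \<omega>" "(SUP s\<in>{0..r}. X s \<omega>) = X s1 \<omega>"
        using s by (auto intro!: antisym INF_lower SUP_upper INF_greatest SUP_least)
      moreover have "hit_time X z \<omega> \<le> t \<longleftrightarrow> (\<exists>s\<in>{0..r}. X s \<omega> = z)"
        using hit_time_le_iff[OF \<omega>] real by simp
      moreover have "(\<exists>s\<in>{0..r}. X s \<omega> = z) \<longleftrightarrow> X s0 \<omega> \<le> z \<and> z \<le> X s1 \<omega>"
        using path_IVT[OF \<omega>, of s0 s1 z] s by fastforce
      ultimately show ?thesis using INF SUP by simp
    qed
    have "Measurable.pred (F (ennreal r))
        (\<lambda>\<omega>. (INF s\<in>?C. X s \<omega>) \<le> z \<and> z \<le> (SUP s\<in>?C. X s \<omega>))"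
      using meas by measurable
    then show ?thesis
      using iff real by (subst measurable_cong[OF iff]) auto
  qed
qed

lemma hit_time_measurable [measurable]: "hit_time X z \<in> borel_measurable M"
  using measurable_stopping_time[OF hit_time_stopping] sub_M space_F by auto

lemma Limsup_at_top_path:
  assumes "\<omega> \<in> space M"
  shows "Limsup at_top (\<lambda>t. X t \<omega>) = (INF n. SUP t\<in>\<rat> \<inter> {real n..}. X t \<omega>)"
proof -
  have "(SUP t\<in>{real n..}. X t \<omega>) = (SUP t\<in>\<rat> \<inter> {real n..}. X t \<omega>)" for n
    by (rule SUP_eq_SUP_dense[OF continuous_on_subset[OF cont_paths[OF assms]] _ _ closure_rats_atLeast])
      auto
  moreover have "Limsup at_top (\<lambda>t. X t \<omega>) = (INF n. SUP t\<in>{real n..}. X t \<omega>)"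
    unfolding Limsup_def
  proof (rule antisym)
    show "(INF P\<in>{P. eventually P at_top}. SUP t\<in>{t. P t}. X t \<omega>) \<le> (INF n. SUP t\<in>{real n..}. X t \<omega>)"
    proof (rule INF_greatest)
      fix n :: nat
      show "(INF P\<in>{P. eventually P at_top}. SUP t\<in>{t. P t}. X t \<omega>) \<le> (SUP t\<in>{real n..}. X t \<omega>)"
        by (rule INF_lower2[of "\<lambda>t. real n \<le> t"]) (auto simp: atLeast_def)
    qed
    show "(INF n. SUP t\<in>{real n..}. X t \<omega>) \<le> (INF P\<in>{P. eventually P at_top}. SUP t\<in>{t. P t}. X t \<omega>)"
    proof (rule INF_greatest)
      fix Q :: "real \<Rightarrow> bool" assume "Q \<in> {P. eventually P at_top}"
      then obtain N where N: "\<And>t. N \<le> t \<Longrightarrow> Q t" by (auto simp: eventually_at_top_linorder)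
      obtain n where "N \<le> real n" using real_arch_simple by blast
      then have "{real n..} \<subseteq> {t. Q t}" using N by auto
      then show "(INF n. SUP t\<in>{real n..}. X t \<omega>) \<le> (SUP t\<in>{t. Q t}. X t \<omega>)"
        by (intro INF_lower2[of n] SUP_subset_mono) auto
    qed
  qed
  ultimately show ?thesis by simp
qed

lemma Limsup_path_measurable [measurable]:
  "(\<lambda>\<omega>. Limsup at_top (\<lambda>t. X t \<omega>)) \<in> borel_measurable M"
proof -
  have "(\<lambda>\<omega>. INF n. SUP t\<in>\<rat> \<inter> {real n..}. X t \<omega>) \<in> borel_measurable M"
    by (intro borel_measurable_INF borel_measurable_SUP X_measurable countable_Int1 countable_rat)
      auto
  then show ?thesis
    by (subst measurable_cong[OF Limsup_at_top_path])
qed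

lemma value_at_exit_time:
  assumes "\<omega> \<in> space M" "0 \<le> a" "b \<le> \<beta>"
  shows "value_at X \<beta> (exit_time X \<beta> a b) \<omega> =
    (if X 0 \<omega> \<notin> {a<..<b} then X 0 \<omega>
     else if hit_time X a \<omega> = \<infinity> \<and> hit_time X b \<omega> = \<infinity> then Limsup at_top (\<lambda>t. X t \<omega>)
     else if hit_time X b \<omega> < hit_time X a \<omega> then b else a)"
  unfolding value_at_first_exit[OF assms, symmetric]
  by (simp add: value_at_def exit_time_eq_first_exit[OF assms(1)])

lemma value_at_exit_time_measurable:
  assumes "0 \<le> a" "b \<le> \<beta>"
  shows "value_at X \<beta> (exit_time X \<beta> a b) \<in> borel_measurable M"
  by (subst measurable_cong[OF value_at_exit_time[OF _ assms]]) auto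

lemma first_exit_eq_min_hit:
  assumes "\<omega> \<in> space M" "X 0 \<omega> \<in> {a<..<b}"
  shows "first_exit X a b \<omega> = min (hit_time X a \<omega>) (hit_time X b \<omega>)"
proof (rule antisym)
  show "first_exit X a b \<omega> \<le> min (hit_time X a \<omega>) (hit_time X b \<omega>)"
    unfolding first_exit_def hit_time_def by (auto intro: INF_superset_mono)
  show "min (hit_time X a \<omega>) (hit_time X b \<omega>) \<le> first_exit X a b \<omega>"
  proof (cases "first_exit X a b \<omega> < \<infinity>")
    case True
    from first_exit_endpoint[OF assms(1) this assms(2)] obtain t where
      "0 \<le> t" "first_exit X a b \<omega> = ennreal t" "X t \<omega> \<in> {a, b}" by blast
    then show ?thesis using hit_time_le_iff[OF assms(1) \<open>0 \<le> t\<close>] by (auto simp: min_le_iff_disj)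
  qed (simp add: less_top[symmetric] top_unique)
qed

lemma first_exit_measurable [measurable]: "first_exit X a b \<in> borel_measurable M"
proof -
  have *: "first_exit X a b \<omega> =
      (if X 0 \<omega> \<in> {a<..<b} then min (hit_time X a \<omega>) (hit_time X b \<omega>) else 0)"
    if "\<omega> \<in> space M" for \<omega>
    using first_exit_eq_min_hit[OF that] first_exit_le_iff[OF that, of 0 a b] by auto
  show ?thesis by (subst measurable_cong[OF *]) auto
qed

end

section \<open>The law of the stopped position\<close>

lemma at_right_end_neq_bot: "0 < \<beta> \<Longrightarrow> at_right_end \<beta> \<noteq> bot"
  by (simp add: at_right_end_def)

lemma eventually_at_right_end:
  assumes "ereal y < \<beta>"
  shows "\<forall>\<^sub>F b in at_right_end \<beta>. y < b \<and> ereal b < \<beta>"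
proof (cases "\<beta> = \<infinity>")
  case True
  then show ?thesis by (simp add: at_right_end_def eventually_gt_at_top)
next
  case False
  then obtain r where r: "\<beta> = ereal r" using assms by (cases \<beta>) auto
  then have "\<forall>\<^sub>F b in at_left r. b \<in> {y<..<r}"
    using assms by (intro eventually_at_leftI[of y]) auto
  then show ?thesis using r by (simp add: at_right_end_def)
qed

lemma (in prob_space) integral_two_valued:
  fixes u v :: real
  assumes "E \<in> events"
  shows "(\<integral>\<omega>. (if \<omega> \<in> E then u else v) \<partial>M) = (1 - prob E) * v + prob E * u"
proof -
  have "(\<integral>\<omega>. (if \<omega> \<in> E then u else v) \<partial>M) = (\<integral>\<omega>. v + (u - v) * indicator E \<omega> \<partial>M)"
    by (intro Bochner_Integration.integral_cong) auto
  also have "\<dots> = v + (u - v) * prob E"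
    using assms by (subst Bochner_Integration.integral_add) (auto simp: prob_space emeasure_eq_measure)
  finally show ?thesis by (simp add: algebra_simps)
qed

text \<open>A strict excess is an open condition in time, so it can be witnessed at a rational time.
  Events about later excesses thereby become countable unions.\<close>

lemma exceeds_at_rational:
  fixes f :: "real \<Rightarrow> ereal"
  assumes "continuous_on {0..} f" "0 \<le> s" "ereal y < f s"
  obtains q where "q \<in> \<rat>" "s \<le> q" "ereal y < f q"
proof -
  have "ereal y < (SUP t\<in>{s..}. f t)"
    using assms(3) by (auto simp: less_SUP_iff)
  also have "\<dots> = (SUP t\<in>\<rat> \<inter> {s..}. f t)"
    using assms(2) by (intro SUP_eq_SUP_dense continuous_on_subset[OF assms(1)] closure_rats_atLeast) auto
  finally show ?thesis using that by (auto simp: less_SUP_iff)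
qed

text \<open>Collects the analytic hypotheses on the scale function, so that the game can be solved
  over this locale without a diffusion.\<close>

locale vanishing_scale =
  fixes \<beta> :: ereal and S :: "real \<Rightarrow> real"
  assumes right_end_pos: "0 < \<beta>"
    and scale_increasing: "strict_mono_on (state_interior \<beta>) S"
    and scale_continuous: "continuous_on (state_interior \<beta>) S"
    and scale_left: "(S \<longlongrightarrow> 0) (at_right 0)"
    and scale_right: "filterlim S at_top (at_right_end \<beta>)"
begin

lemma interiorI: "0 < y \<Longrightarrow> ereal y < \<beta> \<Longrightarrow> y \<in> state_interior \<beta>"
  by (simp add: state_interior_def)

lemma interior_downward: "y \<in> state_interior \<beta> \<Longrightarrow> 0 < z \<Longrightarrow> z \<le> y \<Longrightarrow> z \<in> state_interior \<beta>"
  by (auto simp: state_interior_def intro: le_less_trans[of "ereal z" "ereal y"])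

lemma scale_less: "0 < y \<Longrightarrow> y < z \<Longrightarrow> ereal z < \<beta> \<Longrightarrow> S y < S z"
  using scale_increasing interior_downward[of z y]
  by (auto simp: strict_mono_on_def interiorI)

text \<open>The limit at 0 only yields \<open>0 \<le> S (y / 2)\<close>; strict monotonicity between
  \<open>y / 2\<close> and \<open>y\<close> gives the strict inequality.\<close>

lemma scale_pos:
  assumes "0 < y" "ereal y < \<beta>"
  shows "0 < S y"
proof -
  have "ereal (y / 2) < \<beta>"
    using assms by (intro le_less_trans[OF _ assms(2)]) auto
  have "eventually (\<lambda>z. S z \<le> S (y / 2)) (at_right 0)"
    using assms \<open>ereal (y / 2) < \<beta>\<close>
    by (intro eventually_at_rightI[of 0 "y / 2"]) (auto intro!: less_imp_le scale_less)
  then have "0 \<le> S (y / 2)"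
    by (rule tendsto_upperbound[OF scale_left]) simp
  also have "\<dots> < S y"
    using assms by (intro scale_less) auto
  finally show ?thesis .
qed

lemma scale_ext_0 [simp]: "scale_ext S 0 = 0"
  using tendsto_Lim[OF _ scale_left] by (simp add: scale_ext_def)

end

locale vanishing_scale_diffusion =
  linear_diffusion M F P X \<beta> S m + vanishing_scale \<beta> S
  for M :: "'w measure" and F P X \<beta> S m
begin

section \<open>Exit and hitting probabilities from the scale function\<close>

lemma space_P: "y \<in> state_interior \<beta> \<Longrightarrow> space (P y) = space M"
  using sets_P sets_eq_imp_space_eq by blast

lemma meas_P: "y \<in> state_interior \<beta> \<Longrightarrow> f \<in> borel_measurable M \<Longrightarrow> f \<in> borel_measurable (P y)"
  using measurable_cong_sets[OF sets_P refl] by blast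

lemma sets_PI: "y \<in> state_interior \<beta> \<Longrightarrow> A \<in> sets M \<Longrightarrow> A \<in> sets (P y)"
  using sets_P by blast

lemma less_right_end: "y < b \<Longrightarrow> ereal b < \<beta> \<Longrightarrow> ereal y < \<beta>"
  by (rule less_trans[of _ "ereal b"]) simp_all

text \<open>The mean exit time is finite: it integrates a Green function bounded by
  \<open>S b - S a\<close> against a speed measure that is finite on \<open>[a, b]\<close>.\<close>

lemma first_exit_finite_AE:
  assumes "0 < a" "a < y" "y < b" "ereal b < \<beta>"
  shows "AE \<omega> in P y. first_exit X a b \<omega> < \<infinity>"
proof -
  have y: "y \<in> state_interior \<beta>"
    using assms less_right_end[of y b] by (simp add: interiorI)
  have S: "S a < S y" "S y < S b"
    using assms less_right_end[of y b] by (simp_all add: scale_less)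
  have green: "green S a b y z \<le> S b - S a" if "z \<in> {a<..<b}" for z
  proof -
    have z: "S a < S z" "S z < S b"
      using assms that less_right_end[of z b] by (simp_all add: scale_less)
    have "(S (min y z) - S a) * (S b - S (max y z)) \<le> (S b - S a) * (S b - S a)"
      using S z by (intro mult_mono) (auto simp: min_def max_def)
    then show ?thesis
      unfolding green_def using S by (simp add: divide_simps)
  qed
  have "(\<integral>\<^sup>+\<omega>. first_exit X a b \<omega> \<partial>P y) = (\<integral>\<^sup>+z\<in>{a<..<b}. ennreal (green S a b y z) \<partial>m)"
    using assms by (rule speed_exit)
  also have "\<dots> \<le> (\<integral>\<^sup>+z. ennreal (S b - S a) * indicator {a..b} z \<partial>m)"
    using green by (intro nn_integral_mono) (auto split: split_indicator intro!: ennreal_leI)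
  also have "\<dots> = ennreal (S b - S a) * emeasure m {a..b}"
    by (subst nn_integral_cmult_indicator) (auto simp: sets_speed)
  also have "\<dots> < \<infinity>"
    using speed_finite[of a b] assms by (simp add: ennreal_mult_less_top)
  finally have "(\<integral>\<^sup>+\<omega>. first_exit X a b \<omega> \<partial>P y) \<noteq> \<infinity>" by simp
  then have "AE \<omega> in P y. first_exit X a b \<omega> \<noteq> \<infinity>"
    by (intro nn_integral_noteq_infinite meas_P[OF y]) auto
  then show ?thesis by (simp add: less_top)
qed

lemma hit_time_mono_down:
  assumes "\<omega> \<in> space M" "z \<le> X 0 \<omega>" "z' \<le> z"
  shows "hit_time X z \<omega> \<le> hit_time X z' \<omega>"
proof (cases "hit_time X z' \<omega> < \<infinity>")
  case True
  from hit_time_attained[OF assms(1) this] obtain t where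
    t: "0 \<le> t" "hit_time X z' \<omega> = ennreal t" "X t \<omega> = z'" by blast
  then show ?thesis
    using path_IVT[OF assms(1), of t 0 z] hit_time_le_iff[OF assms(1), of t z] assms by force
qed (simp add: less_top[symmetric])

lemma hit_time_mono_up:
  assumes "\<omega> \<in> space M" "X 0 \<omega> \<le> z" "z \<le> z'"
  shows "hit_time X z \<omega> \<le> hit_time X z' \<omega>"
proof (cases "hit_time X z' \<omega> < \<infinity>")
  case True
  from hit_time_attained[OF assms(1) this] obtain t where
    t: "0 \<le> t" "hit_time X z' \<omega> = ennreal t" "X t \<omega> = z'" by blast
  then show ?thesis
    using path_IVT[OF assms(1), of 0 t z] hit_time_le_iff[OF assms(1), of t z] assms by force
qed (simp add: less_top[symmetric])

lemma hit_before_absorption: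
  assumes "\<omega> \<in> space M" "hit_time X z \<omega> < \<infinity>" "0 < z"
  shows "\<exists>t\<ge>0. hit_time X z \<omega> = ennreal t \<and> (\<forall>s\<in>{0..t}. 0 < X s \<omega>)"
proof -
  from hit_time_attained[OF assms(1,2)] obtain t where
    t: "0 \<le> t" "hit_time X z \<omega> = ennreal t" "X t \<omega> = z" by blast
  have "0 < X s \<omega>" if "s \<in> {0..t}" for s
  proof -
    have "X s \<omega> \<noteq> 0" using absorbed[OF assms(1), of s t] that t assms(3) by auto
    moreover have "0 \<le> X s \<omega>" using range[OF assms(1), of s] that by simp
    ultimately show ?thesis by simp
  qed
  with t(1,2) show ?thesis by auto
qed

lemma hit_time_less_hit_0:
  assumes "\<omega> \<in> space M" "hit_time X z \<omega> < \<infinity>" "0 < z"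
  shows "hit_time X z \<omega> < hit_time X 0 \<omega>"
proof -
  from hit_before_absorption[OF assms] obtain t where
    t: "0 \<le> t" "hit_time X z \<omega> = ennreal t" "\<forall>s\<in>{0..t}. 0 < X s \<omega>" by auto
  have "\<not> hit_time X 0 \<omega> \<le> ennreal t"
    unfolding hit_time_le_iff[OF assms(1) t(1)] using t(3) by (metis less_irrefl)
  then show ?thesis using t by simp
qed

text \<open>Hitting \<open>b\<close> is the increasing union of the events of hitting
  \<open>b\<close> before \<open>a n\<close>, where \<open>a n\<close> decreases to 0. Their
  probabilities come from \<open>scale_hit\<close>, and \<open>S (a n)\<close> tends to 0.\<close>

lemma prob_hit_finite:
  assumes "0 < y" "y < b" "ereal b < \<beta>"
  shows "measure (P y) {\<omega> \<in> space M. hit_time X (ereal b) \<omega> < \<infinity>} = S y / S b"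
proof -
  have y: "y \<in> state_interior \<beta>"
    using assms less_right_end[of y b] by (simp add: interiorI)
  interpret prob_space "P y" using y by (rule prob)
  have S: "S y < S b" "0 < S y" using assms y by (simp_all add: scale_less scale_pos state_interior_def)
  \<comment> \<open>The shift by 2 gives \<open>a n < y\<close> already at \<open>n = 0\<close>, as
    \<open>scale_hit\<close> demands.\<close>
  define a where "a n = y / real (n + 2)" for n :: nat
  have a: "0 < a n" "a n < y" for n
  proof -
    have "y * 1 < y * real (n + 2)" using assms(1) by (intro mult_strict_left_mono) auto
    then show "a n < y" by (simp add: a_def pos_divide_less_eq del: of_nat_add)
    show "0 < a n" using assms(1) by (simp add: a_def)
  qed
  have a_mono: "a n \<le> a k" if "k \<le> n" for k n
    using assms(1) that by (auto simp: a_def intro!: divide_left_mono)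
  have a_lim: "a \<longlonglongrightarrow> 0"
    unfolding a_def using LIMSEQ_ignore_initial_segment[OF lim_const_over_n[of y], of 2] by simp
  \<comment> \<open>Including the starting point makes the events increase for every path, not only
    almost surely: from \<open>y\<close> the level \<open>a n\<close> is met no later than
    \<open>a (Suc n)\<close>.\<close>
  define A where "A n = {\<omega> \<in> space M. X 0 \<omega> = ereal y \<and> hit_time X b \<omega> < hit_time X (a n) \<omega>}" for n
  have start': "AE \<omega> in P y. X 0 \<omega> = ereal y" using start[OF y] .
  have sets: "{\<omega> \<in> space M. hit_time X u \<omega> < hit_time X v \<omega>} \<in> events" for u v
    by (rule sets_PI[OF y]) measurable
  have sets_A: "A n \<in> events" for n
    unfolding A_def by (rule sets_PI[OF y]) measurable
  have meas_A: "prob (A n) = (S y - S (a n)) / (S b - S (a n))" for n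
  proof -
    have "prob (A n) = prob {\<omega> \<in> space M. hit_time X b \<omega> < hit_time X (a n) \<omega>}"
    proof (rule finite_measure_eq_AE[OF _ sets_A sets])
      show "AE \<omega> in P y. \<omega> \<in> A n \<longleftrightarrow> \<omega> \<in> {\<omega> \<in> space M. hit_time X b \<omega> < hit_time X (a n) \<omega>}"
        using start' by eventually_elim (simp add: A_def)
    qed
    then show ?thesis using scale_hit[OF a(1) a(2) assms(2,3)] by simp
  qed
  have "incseq A"
  proof (rule incseq_SucI, rule subsetI)
    fix n \<omega> assume "\<omega> \<in> A n"
    then have \<omega>: "\<omega> \<in> space M" "X 0 \<omega> = ereal y" "hit_time X b \<omega> < hit_time X (a n) \<omega>"
      by (simp_all add: A_def)
    note \<omega>(3)
    also have "hit_time X (a n) \<omega> \<le> hit_time X (a (Suc n)) \<omega>"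
      using a_mono[of n "Suc n"] a(2)[of n] \<omega>(2) by (intro hit_time_mono_down \<omega>(1)) simp_all
    finally show "\<omega> \<in> A (Suc n)" using \<omega> by (simp add: A_def)
  qed
  moreover have "range A \<subseteq> events"
    using sets_A by blast
  ultimately have lim: "(\<lambda>n. prob (A n)) \<longlonglongrightarrow> prob (\<Union>n. A n)"
    by (intro finite_Lim_measure_incseq)
  have Union: "(\<Union>n. A n) = {\<omega> \<in> space M. X 0 \<omega> = ereal y \<and> hit_time X b \<omega> < \<infinity>}" (is "_ = ?H")
  proof (intro equalityI subsetI)
    fix \<omega> assume "\<omega> \<in> (\<Union>n. A n)"
    then obtain n where "\<omega> \<in> A n" by blast
    then have \<omega>: "\<omega> \<in> space M" "X 0 \<omega> = ereal y" "hit_time X b \<omega> < hit_time X (a n) \<omega>"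
      by (simp_all add: A_def)
    from \<omega>(3) have "hit_time X b \<omega> < \<infinity>" by (rule less_le_trans) simp
    with \<omega> show "\<omega> \<in> ?H" by simp
  next
    fix \<omega> assume "\<omega> \<in> ?H"
    then have \<omega>: "\<omega> \<in> space M" "X 0 \<omega> = ereal y" "hit_time X b \<omega> < \<infinity>" by simp_all
    have "0 < ereal b" using assms by simp
    from hit_before_absorption[OF \<omega>(1,3) this] obtain t where
      t: "0 \<le> t" "hit_time X b \<omega> = ennreal t" "\<forall>s\<in>{0..t}. 0 < X s \<omega>" by auto
    \<comment> \<open>Because 0 is absorbing, the path is positive up to the time it hits
      \<open>b\<close>; its minimum up to then is positive, hence above \<open>a n\<close> for some
      \<open>n\<close>.\<close>
    have "continuous_on {0..t} (\<lambda>t. X t \<omega>)"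
      by (rule continuous_on_subset[OF cont_paths[OF \<omega>(1)]]) auto
    from continuous_attains_inf[OF compact_Icc _ this] t(1)
    obtain s0 where s0: "s0 \<in> {0..t}" "\<And>s. s \<in> {0..t} \<Longrightarrow> X s0 \<omega> \<le> X s \<omega>" by auto
    have "ereal 0 < X s0 \<omega>" using bspec[OF t(3) s0(1)] by (simp add: zero_ereal_def)
    moreover have "(\<lambda>n. ereal (a n)) \<longlonglongrightarrow> ereal 0"
      using a_lim by simp
    ultimately have "\<forall>\<^sub>F n in sequentially. ereal (a n) < X s0 \<omega>"
      by (rule order_tendstoD(2)[rotated])
    then obtain n where n: "ereal (a n) < X s0 \<omega>"
      unfolding eventually_sequentially by blast
    have "\<not> hit_time X (a n) \<omega> \<le> ennreal t"
    proof
      assume "hit_time X (a n) \<omega> \<le> ennreal t"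
      then obtain s where "s \<in> {0..t}" "X s \<omega> = a n"
        unfolding hit_time_le_iff[OF \<omega>(1) t(1)] by blast
      with s0(2)[of s] n show False by simp
    qed
    then have "\<omega> \<in> A n"
      using \<omega> t(2) by (simp add: A_def not_le)
    then show "\<omega> \<in> (\<Union>n. A n)" by blast
  qed
  have "prob ?H = prob {\<omega> \<in> space M. hit_time X b \<omega> < \<infinity>}"
  proof (rule finite_measure_eq_AE)
    show "AE \<omega> in P y. \<omega> \<in> ?H \<longleftrightarrow> \<omega> \<in> {\<omega> \<in> space M. hit_time X b \<omega> < \<infinity>}"
      using start' by eventually_elim simp
    show "?H \<in> events" by (rule sets_PI[OF y]) measurable
    show "{\<omega> \<in> space M. hit_time X b \<omega> < \<infinity>} \<in> events" by (rule sets_PI[OF y]) measurable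
  qed
  with lim have lim': "(\<lambda>n. prob (A n)) \<longlonglongrightarrow> prob {\<omega> \<in> space M. hit_time X b \<omega> < \<infinity>}"
    by (simp only: Union)
  have "filterlim a (at_right 0) sequentially"
    unfolding filterlim_at using a(1) a_lim by (simp add: less_imp_neq[symmetric])
  from filterlim_compose[OF scale_left this]
  have "(\<lambda>n. prob (A n)) \<longlonglongrightarrow> (S y - 0) / (S b - 0)"
    unfolding meas_A using S
    by (intro tendsto_divide tendsto_diff tendsto_const) simp_all
  from LIMSEQ_unique[OF lim' this] show ?thesis by simp
qed

lemma tendsto_divide_scale:
  "((\<lambda>b. u / (S b - v)) \<longlongrightarrow> 0) (at_right_end \<beta>)"
proof -
  have "filterlim (\<lambda>b. - v + S b) at_top (at_right_end \<beta>)"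
    by (rule filterlim_tendsto_add_at_top[OF tendsto_const scale_right])
  from tendsto_mult_right_zero[OF tendsto_inverse_0_at_top[OF this], of u]
  show ?thesis by (simp add: divide_inverse)
qed

text \<open>Serves two null events below: never descending to a level, and reaching \<beta>. Each
  entails, for every \<open>b\<close>, an event about \<open>b\<close> whose probability vanishes
  because \<open>S\<close> tends to infinity.\<close>

lemma AE_zero_by_bounds:
  assumes y: "y \<in> state_interior \<beta>" and A: "A \<in> sets M"
    and lim: "(g \<longlongrightarrow> 0) (at_right_end \<beta>)"
    and le: "\<And>b. y < b \<Longrightarrow> ereal b < \<beta> \<Longrightarrow> measure (P y) A \<le> g b"
  shows "AE \<omega> in P y. \<omega> \<notin> A"
proof -
  interpret prob_space "P y" using y by (rule prob)
  have "\<forall>\<^sub>F b in at_right_end \<beta>. prob A \<le> g b"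
    using eventually_at_right_end[of y \<beta>] y le by (auto simp: state_interior_def elim: eventually_mono)
  then have "prob A \<le> 0"
    by (rule tendsto_lowerbound[OF lim _ at_right_end_neq_bot[OF pos_right_end]])
  then have "prob A = 0" by (simp add: measure_le_0_iff)
  then show ?thesis using sets_PI[OF y A] by (simp add: prob_eq_0)
qed

text \<open>A path that never reaches \<open>a\<close> still leaves every \<open>(a, b)\<close>
  almost surely, hence at \<open>b\<close>.\<close>

lemma hit_lower_finite_AE:
  assumes "0 < a" "a < y" "ereal y < \<beta>"
  shows "AE \<omega> in P y. hit_time X (ereal a) \<omega> < \<infinity>"
proof -
  have y: "y \<in> state_interior \<beta>" using assms by (auto intro!: interiorI)
  interpret prob_space "P y" using y by (rule prob)
  let ?A = "{\<omega> \<in> space M. hit_time X a \<omega> = \<infinity>}"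
  have "AE \<omega> in P y. \<omega> \<notin> ?A"
  proof (rule AE_zero_by_bounds[OF y])
    show "?A \<in> sets M" by measurable
    show "((\<lambda>b. (S y - S a) / (S b - S a)) \<longlongrightarrow> 0) (at_right_end \<beta>)" by (rule tendsto_divide_scale)
    fix b assume b: "y < b" "ereal b < \<beta>"
    have "prob ?A \<le> prob {\<omega> \<in> space M. hit_time X b \<omega> < hit_time X a \<omega>}"
    proof (rule finite_measure_mono_AE)
      show "AE \<omega> in P y. \<omega> \<in> ?A \<longrightarrow> \<omega> \<in> {\<omega> \<in> space M. hit_time X b \<omega> < hit_time X a \<omega>}"
        using first_exit_finite_AE[OF assms(1,2) b] start[OF y] AE_space[of "P y"]
      proof eventually_elim
        case (elim \<omega>)
        then have \<omega>: "\<omega> \<in> space M" by (simp add: space_P[OF y])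
        have "min (hit_time X a \<omega>) (hit_time X b \<omega>) < \<infinity>"
          using first_exit_eq_min_hit[OF \<omega>, of a b] elim assms b by simp
        then show ?case using \<omega> by (auto simp: min_less_iff_disj)
      qed
      show "{\<omega> \<in> space M. hit_time X b \<omega> < hit_time X a \<omega>} \<in> events"
        by (rule sets_PI[OF y]) measurable
    qed
    also have "\<dots> = (S y - S a) / (S b - S a)"
      using assms b by (intro scale_hit)
    finally show "prob ?A \<le> (S y - S a) / (S b - S a)" .
  qed
  then show ?thesis
    using AE_space[of "P y"] by eventually_elim (auto simp: space_P[OF y] less_top)
qed

text \<open>On the way to \<beta> the path passes every \<open>b\<close> in between, which has
  probability \<open>S y / S b\<close>.\<close>

lemma hit_right_end_AE:
  assumes y: "y \<in> state_interior \<beta>"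
  shows "AE \<omega> in P y. hit_time X \<beta> \<omega> = \<infinity>"
proof -
  interpret prob_space "P y" using y by (rule prob)
  let ?A = "{\<omega> \<in> space M. X 0 \<omega> = ereal y \<and> hit_time X \<beta> \<omega> < \<infinity>}"
  have "AE \<omega> in P y. \<omega> \<notin> ?A"
  proof (rule AE_zero_by_bounds[OF y])
    show "?A \<in> sets M" by measurable
    show "((\<lambda>b. S y / (S b - 0)) \<longlongrightarrow> 0) (at_right_end \<beta>)" by (rule tendsto_divide_scale)
    fix b assume b: "y < b" "ereal b < \<beta>"
    have "prob ?A \<le> prob {\<omega> \<in> space M. hit_time X b \<omega> < \<infinity>}"
    proof (rule finite_measure_mono)
      show "?A \<subseteq> {\<omega> \<in> space M. hit_time X b \<omega> < \<infinity>}"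
      proof
        fix \<omega> assume \<omega>: "\<omega> \<in> ?A"
        then have "hit_time X b \<omega> \<le> hit_time X \<beta> \<omega>"
          using b by (intro hit_time_mono_up) auto
        then show "\<omega> \<in> {\<omega> \<in> space M. hit_time X b \<omega> < \<infinity>}"
          using \<omega> by (auto intro: le_less_trans)
      qed
      show "{\<omega> \<in> space M. hit_time X b \<omega> < \<infinity>} \<in> events"
        by (rule sets_PI[OF y]) measurable
    qed
    also have "\<dots> = S y / (S b - 0)"
      using b y prob_hit_finite[of y b] by (simp add: state_interior_def)
    finally show "prob ?A \<le> S y / (S b - 0)" .
  qed
  then show ?thesis
    using AE_space[of "P y"] start[OF y] by eventually_elim (auto simp: space_P[OF y] less_top[symmetric])
qed

section \<open>Convergence of the path to the left end point\<close>

lemma path_exceeds_measurable: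
  "{p \<in> space path_space. \<exists>q\<in>\<rat> \<inter> {0..}. ereal y < p q} \<in> sets path_space"
proof -
  have "(\<lambda>p. p q) \<in> borel_measurable path_space" if "q \<in> \<rat> \<inter> {0..}" for q
    unfolding path_space_def using that by (intro measurable_component_singleton) auto
  then have "{p \<in> space path_space. ereal y < p q} \<in> sets path_space" if "q \<in> \<rat> \<inter> {0..}" for q
    using that by (intro borel_measurable_less) auto
  then have "(\<Union>q\<in>\<rat> \<inter> {0..}. {p \<in> space path_space. ereal y < p q}) \<in> sets path_space"
    by (intro sets.countable_UN'' countable_Int1 countable_rat) auto
  moreover have "(\<Union>q\<in>\<rat> \<inter> {0..}. {p \<in> space path_space. ereal y < p q}) =
      {p \<in> space path_space. \<exists>q\<in>\<rat> \<inter> {0..}. ereal y < p q}" by auto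
  ultimately show ?thesis by simp
qed

lemma sample_path_measurable: "sample_path X \<in> M \<rightarrow>\<^sub>M path_space"
  unfolding path_space_def sample_path_def by (intro measurable_restrict) auto

lemma sample_path_in_space: "sample_path Y \<omega> \<in> space path_space"
  by (simp add: path_space_def sample_path_def space_PiM)

lemma path_law_exceeds:
  assumes "0 < a" "a < y" "ereal y < \<beta>"
  shows "emeasure (distr (P a) path_space (sample_path X))
      {p \<in> space path_space. \<exists>q\<in>\<rat> \<inter> {0..}. ereal y < p q} \<le> ennreal (S a / S y)"
proof -
  have a: "a \<in> state_interior \<beta>"
    using assms less_right_end[of a y] by (simp add: interiorI)
  interpret prob_space "P a" using a by (rule prob)
  let ?B = "{p \<in> space path_space. \<exists>q\<in>\<rat> \<inter> {0..}. ereal y < p q}"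
  have "sample_path X \<in> P a \<rightarrow>\<^sub>M path_space"
    using sample_path_measurable measurable_cong_sets[OF sets_P[OF a] refl] by blast
  then have "emeasure (distr (P a) path_space (sample_path X)) ?B =
      emeasure (P a) (sample_path X -` ?B \<inter> space (P a))"
    using path_exceeds_measurable by (intro emeasure_distr)
  also have "\<dots> \<le> emeasure (P a) {\<omega> \<in> space M. hit_time X y \<omega> < \<infinity>}"
  proof (rule emeasure_mono_AE)
    show "AE \<omega> in P a. \<omega> \<in> sample_path X -` ?B \<inter> space (P a) \<longrightarrow> \<omega> \<in> {\<omega> \<in> space M. hit_time X y \<omega> < \<infinity>}"
      using start[OF a]
    proof eventually_elim
      case (elim \<omega>)
      have "\<exists>s\<ge>0. X s \<omega> = y" if "\<omega> \<in> space M" "0 \<le> q" "ereal y < X q \<omega>" for q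
        using path_IVT[OF that(1), of 0 q y] that assms elim by force
      then show ?case
        by (auto simp: space_P[OF a] sample_path_def hit_time_finite_iff[unfolded infinity_ennreal_def])
    qed
    show "{\<omega> \<in> space M. hit_time X y \<omega> < \<infinity>} \<in> events"
      by (rule sets_PI[OF a]) measurable
  qed
  also have "\<dots> = ennreal (S a / S y)"
    unfolding emeasure_eq_measure using prob_hit_finite[OF assms] by simp
  finally show ?thesis .
qed

text \<open>The level \<open>a\<close> is reached almost surely. From then on the path has the law
  of one started at \<open>a\<close>, which ever exceeds \<open>y\<close> with probability at most
  \<open>S a / S y\<close>.\<close>

lemma prob_Limsup_greater:
  assumes "0 < a" "a < y" "a < x" "ereal y < \<beta>" "ereal x < \<beta>"
  shows "measure (P x) {\<omega> \<in> space M. ereal y < Limsup at_top (\<lambda>t. X t \<omega>)} \<le> S a / S y"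
proof -
  have x: "x \<in> state_interior \<beta>" using assms by (auto intro!: interiorI)
  interpret prob_space "P x" using x by (rule prob)
  let ?T = "hit_time X a"
  let ?B = "{p \<in> space path_space. \<exists>q\<in>\<rat> \<inter> {0..}. ereal y < p q}"
  define D where "D = {\<omega> \<in> space M. ?T \<omega> < \<infinity> \<and> 0 < X (enn2real (?T \<omega>)) \<omega> \<and> X (enn2real (?T \<omega>)) \<omega> < \<beta>}"
  let ?C = "{\<omega> \<in> D. sample_path (\<lambda>t. X (enn2real (?T \<omega>) + t)) \<omega> \<in> ?B}"
  have a\<beta>: "ereal a < \<beta>" using assms less_right_end by blast
  have at: "X (enn2real (?T \<omega>)) \<omega> = a" if "\<omega> \<in> space M" "?T \<omega> < \<infinity>" for \<omega>
    using hit_time_attained[OF that] by (metis enn2real_ennreal)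
  have "emeasure (P x) ?C = (\<integral>\<^sup>+\<omega>. indicator D \<omega> *
      emeasure (distr (P (real_of_ereal (X (enn2real (?T \<omega>)) \<omega>))) path_space (sample_path X)) ?B \<partial>P x)"
  proof (rule strong_Markov[OF x hit_time_stopping _ path_exceeds_measurable D_def])
    show "space M \<in> sets (pre_sigma ?T)"
      using sets.top[of "pre_sigma ?T"] by (simp add: space_pre_sigma)
  qed
  also have "\<dots> \<le> (\<integral>\<^sup>+\<omega>. ennreal (S a / S y) \<partial>P x)"
    using path_law_exceeds[OF assms(1,2,4)] at
    by (intro nn_integral_mono) (auto simp: D_def split: split_indicator)
  also have "\<dots> = ennreal (S a / S y)" by (simp add: emeasure_space_1)
  finally have le: "emeasure (P x) ?C \<le> ennreal (S a / S y)" .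
  \<comment> \<open>\<open>?C\<close> looks at times that are rational relative to
    \<open>?T\<close>, \<open>E\<close> at times that are rational in absolute terms.
    \<open>E\<close> is visibly measurable, and continuity makes the two sets equal.\<close>
  define E where "E = {\<omega> \<in> space M. \<exists>r\<in>\<rat> \<inter> {0..}. ?T \<omega> \<le> ennreal r \<and> ereal y < X r \<omega>}"
  have "(\<Union>r\<in>\<rat> \<inter> {0..}. {\<omega> \<in> space M. ?T \<omega> \<le> ennreal r \<and> ereal y < X r \<omega>}) \<in> sets M"
    by (intro sets.countable_UN'' countable_Int1 countable_rat) auto
  also have "(\<Union>r\<in>\<rat> \<inter> {0..}. {\<omega> \<in> space M. ?T \<omega> \<le> ennreal r \<and> ereal y < X r \<omega>}) = E"
    by (auto simp: E_def)
  finally have E_meas: "E \<in> sets M" .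
  have "E = ?C"
  proof (intro equalityI subsetI)
    fix \<omega> assume "\<omega> \<in> E"
    then obtain r where r: "\<omega> \<in> space M" "0 \<le> r" "?T \<omega> \<le> ennreal r" "ereal y < X r \<omega>"
      by (auto simp: E_def)
    then have fin: "?T \<omega> < \<infinity>" by (auto intro: le_less_trans)
    from hit_time_attained[OF r(1) fin] obtain t where t: "0 \<le> t" "?T \<omega> = ennreal t" by blast
    have "t \<le> r" using r t by simp
    have "continuous_on {0..} (\<lambda>u. X (t + u) \<omega>)"
      using t(1) by (intro continuous_on_compose2[OF cont_paths[OF r(1)]] continuous_intros) auto
    from exceeds_at_rational[OF this, of "r - t" y] obtain q where
      "q \<in> \<rat>" "r - t \<le> q" "ereal y < X (t + q) \<omega>" using \<open>t \<le> r\<close> r(4) by auto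
    then show "\<omega> \<in> ?C"
      using at[OF r(1) fin] a\<beta> assms(1) fin r(1) t \<open>t \<le> r\<close> sample_path_in_space
      by (auto simp: D_def sample_path_def intro!: bexI[of _ q])
  next
    fix \<omega> assume C: "\<omega> \<in> ?C"
    then have \<omega>: "\<omega> \<in> space M" "?T \<omega> < \<infinity>" by (auto simp: D_def)
    from hit_time_attained[OF \<omega>] obtain t where t: "0 \<le> t" "?T \<omega> = ennreal t" by blast
    obtain q where q: "0 \<le> q" "ereal y < X (t + q) \<omega>"
      using C t by (auto simp: sample_path_def)
    from exceeds_at_rational[OF cont_paths[OF \<omega>(1)], of "t + q" y] obtain r where
      "r \<in> \<rat>" "t + q \<le> r" "ereal y < X r \<omega>" using t q by auto
    then show "\<omega> \<in> E"
      using \<omega> t q by (auto simp: E_def intro!: bexI[of _ r] ennreal_leI)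
  qed
  then have "emeasure (P x) E \<le> ennreal (S a / S y)" using le by simp
  moreover have "0 \<le> S a / S y"
    using assms a\<beta> scale_pos[of a] scale_pos[of y] by simp
  ultimately have "prob E \<le> S a / S y"
    by (simp add: emeasure_eq_measure)
  moreover have "prob {\<omega> \<in> space M. ereal y < Limsup at_top (\<lambda>t. X t \<omega>)} \<le> prob E"
  proof (rule finite_measure_mono_AE[OF _ sets_PI[OF x E_meas]])
    show "AE \<omega> in P x. \<omega> \<in> {\<omega> \<in> space M. ereal y < Limsup at_top (\<lambda>t. X t \<omega>)} \<longrightarrow> \<omega> \<in> E"
      using hit_lower_finite_AE[OF assms(1,3,5)]
    proof eventually_elim
      case (elim \<omega>)
      show ?case
      proof
        assume "\<omega> \<in> {\<omega> \<in> space M. ereal y < Limsup at_top (\<lambda>t. X t \<omega>)}"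
        then have \<omega>: "\<omega> \<in> space M" "ereal y < Limsup at_top (\<lambda>t. X t \<omega>)" by auto
        from hit_time_attained[OF \<omega>(1) elim] obtain t where t: "0 \<le> t" "?T \<omega> = ennreal t" by blast
        obtain n where n: "t \<le> real n" using real_arch_simple by blast
        have "Limsup at_top (\<lambda>t. X t \<omega>) \<le> (SUP q\<in>\<rat> \<inter> {real n..}. X q \<omega>)"
          unfolding Limsup_at_top_path[OF \<omega>(1)] by (rule INF_lower) simp
        with \<omega>(2) have "ereal y < (SUP q\<in>\<rat> \<inter> {real n..}. X q \<omega>)" by (rule less_le_trans)
        then obtain q where "q \<in> \<rat>" "real n \<le> q" "ereal y < X q \<omega>" by (auto simp: less_SUP_iff)
        then show "\<omega> \<in> E"
          using \<omega> t n by (auto simp: E_def intro!: bexI[of _ q] ennreal_leI)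
      qed
    qed
  qed
  ultimately show ?thesis by simp
qed

text \<open>Letting \<open>a\<close> tend to 0 in the previous bound shows that each positive level
  \<open>y\<close> is exceeded in the limit with probability 0; the countably many levels
  \<open>x / real (Suc n)\<close> suffice.\<close>

lemma Limsup_path_AE:
  assumes x: "x \<in> state_interior \<beta>"
  shows "AE \<omega> in P x. Limsup at_top (\<lambda>t. X t \<omega>) = 0"
proof -
  interpret prob_space "P x" using x by (rule prob)
  have x0: "0 < x" "ereal x < \<beta>" using x by (auto simp: state_interior_def)
  have "AE \<omega> in P x. Limsup at_top (\<lambda>t. X t \<omega>) \<le> ereal y" if y: "0 < y" "ereal y < \<beta>" for y
  proof -
    let ?A = "{\<omega> \<in> space M. ereal y < Limsup at_top (\<lambda>t. X t \<omega>)}"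
    have ev: "\<forall>\<^sub>F a in at_right 0. prob ?A \<le> S a / S y"
    proof (rule eventually_at_rightI[of 0 "min x y"])
      show "prob ?A \<le> S a / S y" if "a \<in> {0<..<min x y}" for a
        using that x0 y by (intro prob_Limsup_greater) simp_all
    qed (use x0 y in simp)
    have "((\<lambda>a. S a / S y) \<longlongrightarrow> 0 / S y) (at_right 0)"
      using scale_pos[OF y] by (intro tendsto_divide scale_left tendsto_const) simp
    from tendsto_lowerbound[OF this ev] have "prob ?A = 0"
      by (simp add: measure_le_0_iff)
    moreover have "?A \<in> events"
      by (intro sets_PI[OF x] borel_measurable_less Limsup_path_measurable borel_measurable_const)
    ultimately have "AE \<omega> in P x. \<omega> \<notin> ?A" by (simp only: prob_eq_0)
    then show ?thesis
      using AE_space[of "P x"] by eventually_elim (simp add: space_P[OF x] not_less)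
  qed
  moreover have "0 < x / real (Suc n) \<and> ereal (x / real (Suc n)) < \<beta>" for n
  proof -
    have "x / real (Suc n) \<le> x / 1" using x0 by (intro divide_left_mono) auto
    then show ?thesis using x0 by (auto intro: le_less_trans[of _ "ereal x"])
  qed
  ultimately have "AE \<omega> in P x. \<forall>n. Limsup at_top (\<lambda>t. X t \<omega>) \<le> ereal (x / real (Suc n))"
    unfolding AE_all_countable by blast
  then show ?thesis
    using AE_space[of "P x"]
  proof eventually_elim
    case (elim \<omega>)
    have lim: "(\<lambda>n. ereal (x / real (Suc n))) \<longlonglongrightarrow> ereal 0"
      using LIMSEQ_Suc[OF lim_const_over_n[of x]] by simp
    have ev: "\<forall>\<^sub>F n in sequentially. Limsup at_top (\<lambda>t. X t \<omega>) \<le> ereal (x / real (Suc n))"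
      using elim(1) by (rule always_eventually)
    have "Limsup at_top (\<lambda>t. X t \<omega>) \<le> ereal 0"
      by (rule tendsto_lowerbound[OF lim ev]) simp
    moreover have "0 \<le> Limsup at_top (\<lambda>t. X t \<omega>)"
      using range[of \<omega>] elim(2) space_P[OF x]
      by (intro le_Limsup eventually_at_top_linorderI[of 0]) auto
    ultimately show ?case by (simp add: zero_ereal_def)
  qed
qed

section \<open>Law of the exit position and the payoff\<close>

lemma prob_hit_upper:
  assumes "0 \<le> a" "a < x" "x < b" "ereal b \<le> \<beta>"
  shows "measure (P x) {\<omega> \<in> space M. hit_time X b \<omega> < hit_time X a \<omega>} =
    (if ereal b = \<beta> then 0 else (S x - scale_ext S a) / (S b - scale_ext S a))"
proof -
  have x: "x \<in> state_interior \<beta>"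
    using assms by (intro interiorI, simp, intro less_le_trans[OF _ assms(4)]) simp
  interpret prob_space "P x" using x by (rule prob)
  let ?E = "{\<omega> \<in> space M. hit_time X b \<omega> < hit_time X a \<omega>}"
  have E: "?E \<in> events" by (rule sets_PI[OF x]) measurable
  consider "ereal b = \<beta>" | "ereal b < \<beta>" "a = 0" | "ereal b < \<beta>" "0 < a"
    using assms(1,4) unfolding order_le_less by blast
  then show ?thesis
  proof cases
    case 1
    have "AE \<omega> in P x. \<omega> \<notin> ?E"
      using hit_right_end_AE[OF x] unfolding 1[symmetric] by eventually_elim simp
    then have "prob ?E = 0" using E by (simp only: prob_eq_0)
    then show ?thesis using 1 by simp
  next
    case 2
    \<comment> \<open>A path that hits \<open>b\<close> at all does so before 0, since it could not
      return from there.\<close>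
    have "hit_time X b \<omega> < hit_time X a \<omega> \<longleftrightarrow> hit_time X b \<omega> < \<infinity>" if "\<omega> \<in> space M" for \<omega>
    proof
      assume "hit_time X b \<omega> < hit_time X a \<omega>"
      then show "hit_time X b \<omega> < \<infinity>" by (rule less_le_trans) simp
    next
      assume "hit_time X b \<omega> < \<infinity>"
      then show "hit_time X b \<omega> < hit_time X a \<omega>"
        using hit_time_less_hit_0[OF that, of "ereal b"] 2 assms by (simp add: zero_ereal_def)
    qed
    then have "?E = {\<omega> \<in> space M. hit_time X b \<omega> < \<infinity>}" by blast
    then show ?thesis
      using prob_hit_finite[of x b] 2 assms by (simp add: scale_ext_0)
  next
    case 3
    then show ?thesis
      using scale_hit[of a x b] assms by (auto simp: scale_ext_def)
  qed
qed

lemma payoff_eq: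
  assumes x: "x \<in> state_interior \<beta>" and ab: "0 \<le> a" "a \<le> x" "x \<le> b" "ereal b \<le> \<beta>"
  defines "w \<equiv> if ereal b = \<beta> then 0 else (S x - scale_ext S a) / (S b - scale_ext S a)"
  shows "payoff P X \<beta> x (a, b) c = (1 - w) * (a - c)\<^sup>2 + w * (b - c)\<^sup>2"
proof -
  interpret prob_space "P x" using x by (rule prob)
  have x0: "0 < x" "ereal x < \<beta>" using x by (auto simp: state_interior_def)
  let ?Y = "value_at X \<beta> (exit_time X \<beta> (ereal a) (ereal b))"
  have Y_eq: "?Y \<omega> = (if X 0 \<omega> \<notin> {ereal a<..<ereal b} then X 0 \<omega>
     else if hit_time X a \<omega> = \<infinity> \<and> hit_time X b \<omega> = \<infinity> then Limsup at_top (\<lambda>t. X t \<omega>)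
     else if hit_time X b \<omega> < hit_time X a \<omega> then ereal b else ereal a)" if "\<omega> \<in> space (P x)" for \<omega>
    using that ab by (intro value_at_exit_time) (auto simp: space_P[OF x])
  have "?Y \<in> borel_measurable (P x)"
    using ab by (intro meas_P[OF x] value_at_exit_time_measurable) auto
  then have meas: "(\<lambda>\<omega>. (real_of_ereal (?Y \<omega>) - c)\<^sup>2) \<in> borel_measurable (P x)" by measurable
  have payoff: "payoff P X \<beta> x (a, b) c = (1 - prob E) * (a - c)\<^sup>2 + prob E * (b - c)\<^sup>2"
    if E: "E \<in> events" and ae: "AE \<omega> in P x. ?Y \<omega> = ereal (if \<omega> \<in> E then b else a)" for E
  proof -
    have "payoff P X \<beta> x (a, b) c = (\<integral>\<omega>. (if \<omega> \<in> E then (b - c)\<^sup>2 else (a - c)\<^sup>2) \<partial>P x)"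
      unfolding payoff_def fst_conv snd_conv
    proof (rule integral_cong_AE[OF meas])
      show "(\<lambda>\<omega>. if \<omega> \<in> E then (b - c)\<^sup>2 else (a - c)\<^sup>2) \<in> borel_measurable (P x)"
        using E by measurable
      show "AE \<omega> in P x. (real_of_ereal (?Y \<omega>) - c)\<^sup>2 = (if \<omega> \<in> E then (b - c)\<^sup>2 else (a - c)\<^sup>2)"
        using ae by eventually_elim auto
    qed
    then show ?thesis using integral_two_valued[OF E] by simp
  qed
  have Sa: "scale_ext S a < S x" if "a < x"
    using that ab x0 scale_pos[of x] scale_less[of a x] scale_ext_0 by (cases "a = 0") (auto simp: scale_ext_def)
  consider "a = x" | "b = x" "a < x" | "a < x" "x < b" using ab by force
  then show ?thesis
  proof cases
    case 1
    \<comment> \<open>Immediate stopping counts as an exit at \<open>a\<close> when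
      \<open>a = x\<close>, matching \<open>w = 0\<close>, and below as an exit at \<open>b\<close>
      when \<open>b = x\<close> and \<open>a < x\<close>, matching \<open>w = 1\<close>.\<close>
    have "AE \<omega> in P x. ?Y \<omega> = ereal (if \<omega> \<in> {} then b else a)"
      using start[OF x] AE_space[of "P x"]
    proof eventually_elim
      case (elim \<omega>)
      then show ?case using Y_eq[OF elim(2)] 1 by simp
    qed
    from payoff[OF _ this] show ?thesis using x0 by (simp add: w_def 1 scale_ext_def)
  next
    case 2
    have "AE \<omega> in P x. ?Y \<omega> = ereal (if \<omega> \<in> space (P x) then b else a)"
      using start[OF x] AE_space[of "P x"]
    proof eventually_elim
      case (elim \<omega>)
      then show ?case using Y_eq[OF elim(2)] 2 by simp
    qed
    from payoff[OF _ this] show ?thesis using x0 Sa 2 by (auto simp: w_def prob_space)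
  next
    case 3
    let ?E = "{\<omega> \<in> space M. hit_time X b \<omega> < hit_time X a \<omega>}"
    have E: "?E \<in> events" by (rule sets_PI[OF x]) measurable
    \<comment> \<open>Paths that hit neither end point count as exits at \<open>a\<close>: for
      \<open>a = 0\<close> they tend to 0, for \<open>a > 0\<close> they form a null set.\<close>
    have trap: "AE \<omega> in P x. hit_time X a \<omega> = \<infinity> \<and> hit_time X b \<omega> = \<infinity> \<longrightarrow> Limsup at_top (\<lambda>t. X t \<omega>) = a"
    proof (cases "a = 0")
      case True
      then show ?thesis
        using Limsup_path_AE[OF x] by eventually_elim (simp add: True)
    next
      case False
      then show ?thesis
        using hit_lower_finite_AE[of a x] ab(1) 3 x0 by (auto elim: eventually_mono)
    qed
    have "AE \<omega> in P x. ?Y \<omega> = ereal (if \<omega> \<in> ?E then b else a)"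
      using start[OF x] AE_space[of "P x"] trap
    proof eventually_elim
      case (elim \<omega>)
      then show ?case using Y_eq[OF elim(2)] 3 by (auto simp: space_P[OF x])
    qed
    from payoff[OF E this] show ?thesis
      using prob_hit_upper[of a x b] ab 3 by (simp add: w_def)
  qed
qed

text \<open>The hitting probability is \<open>S x / S b\<close>, so up to the constant
  \<open>S x\<close> the decay hypothesis concerns the scale function alone.\<close>

lemma scale_decay:
  assumes x: "x \<in> state_interior \<beta>"
    and decay: "((\<lambda>b. measure (P x) {\<omega> \<in> space M. hit_time X (ereal b) \<omega> < \<infinity>} * b\<^sup>2) \<longlongrightarrow> 0)
      (at_right_end \<beta>)"
  shows "((\<lambda>b. b\<^sup>2 / S b) \<longlongrightarrow> 0) (at_right_end \<beta>)"
proof (rule Lim_transform_eventually)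
  have x0: "0 < x" "ereal x < \<beta>" using x by (auto simp: state_interior_def)
  show "((\<lambda>b. 1 / S x * (measure (P x) {\<omega> \<in> space M. hit_time X (ereal b) \<omega> < \<infinity>} * b\<^sup>2)) \<longlongrightarrow> 0)
      (at_right_end \<beta>)"
    using tendsto_mult_right_zero[OF decay, of "1 / S x"] by simp
  show "\<forall>\<^sub>F b in at_right_end \<beta>.
      1 / S x * (measure (P x) {\<omega> \<in> space M. hit_time X (ereal b) \<omega> < \<infinity>} * b\<^sup>2) = b\<^sup>2 / S b"
    using eventually_at_right_end[OF x0(2)]
  proof eventually_elim
    case (elim b)
    then show ?case
      using prob_hit_finite[of x b] x0 scale_pos[of x] by simp
  qed
qed

end

section \<open>Best replies\<close>

text \<open>For functions with one critical point: the scale at 0, its reciprocal at \<beta>, and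
  the moments at \<open>(x, x)\<close>.\<close>

lemma continuous_on_punctured:
  fixes f :: "'a::t1_space \<Rightarrow> 'b::topological_space"
  assumes "continuous_on (A - {q}) f" "(f \<longlongrightarrow> f q) (at q within A)"
  shows "continuous_on A f"
  unfolding continuous_on_def
proof
  fix p assume p: "p \<in> A"
  show "(f \<longlongrightarrow> f p) (at p within A)"
  proof (cases "p = q")
    case False
    then have eq: "at p within (A - {q}) = at p within A"
      by (intro at_within_nhd[of p "- {q}"]) (auto intro: open_Compl)
    have "(f \<longlongrightarrow> f p) (at p within (A - {q}))"
      using assms(1) p False by (auto simp: continuous_on_def)
    then show ?thesis
      unfolding eq .
  qed (use assms(2) in simp)
qed

text \<open>The sets of \<open>c\<close> that admit a best reply with mean above, respectively below, \<open>c\<close> are closed and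
  cover the interval, so they meet by connectedness.\<close>

lemma balanced_best_replies:
  fixes E Q :: "'s::metric_space \<Rightarrow> real" and K :: "'s \<Rightarrow> real \<Rightarrow> real"
  defines "K \<equiv> \<lambda>s c. c\<^sup>2 - 2 * c * E s + Q s"
  assumes "compact D" "D \<noteq> {}" "continuous_on D E" "continuous_on D Q" "0 \<le> u"
    and low: "\<And>s. s \<in> D \<Longrightarrow> 0 \<le> E s"
    and high: "\<And>s. s \<in> D \<Longrightarrow> (\<And>s'. s' \<in> D \<Longrightarrow> K s' u \<le> K s u) \<Longrightarrow> E s \<le> u"
  obtains c s1 s2 where "c \<in> {0..u}" "s1 \<in> D" "s2 \<in> D" "\<And>s. s \<in> D \<Longrightarrow> K s c \<le> K s1 c"
    "\<And>s. s \<in> D \<Longrightarrow> K s c \<le> K s2 c" "E s2 \<le> c" "c \<le> E s1"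
proof -
  define BR where "BR = {p \<in> {0..u} \<times> D. \<forall>s\<in>D. K s (fst p) \<le> K (snd p) (fst p)}"
  define L where "L = fst ` {p \<in> BR. fst p \<le> E (snd p)}"
  define U where "U = fst ` {p \<in> BR. E (snd p) \<le> fst p}"
  have cpt: "compact ({0..u} \<times> D)" using assms(2) by (intro compact_Times) auto
  have cont: "continuous_on ({0..u} \<times> D) (\<lambda>p. E (snd p))" "continuous_on ({0..u} \<times> D) (\<lambda>p. Q (snd p))"
    using assms(4,5) by (auto intro!: continuous_on_compose2[OF _ continuous_on_snd])
  have closed_le: "closed {p \<in> {0..u} \<times> D. f p \<le> g p}"
    if "continuous_on ({0..u} \<times> D) f" "continuous_on ({0..u} \<times> D) g" for f g :: "real \<times> 's \<Rightarrow> real"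
  proof -
    have "closed (({0..u} \<times> D) \<inter> (\<lambda>p. g p - f p) -` {0..})"
      by (intro continuous_closed_preimage continuous_intros that compact_imp_closed[OF cpt])
    moreover have "({0..u} \<times> D) \<inter> (\<lambda>p. g p - f p) -` {0..} = {p \<in> {0..u} \<times> D. f p \<le> g p}" by auto
    ultimately show ?thesis by simp
  qed
  \<comment> \<open>The graph of the best-reply relation is an intersection of closed sets, one for
    each competitor \<open>s\<close>. Its relevant parts are compact, so their projections
    \<open>L\<close> and \<open>U\<close> are closed.\<close>
  have "closed (\<Inter>s\<in>D. {p \<in> {0..u} \<times> D. K s (fst p) \<le> K (snd p) (fst p)})"
    unfolding K_def by (intro closed_INT ballI closed_le continuous_intros cont)
  moreover have "BR = (\<Inter>s\<in>D. {p \<in> {0..u} \<times> D. K s (fst p) \<le> K (snd p) (fst p)})"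
    using \<open>D \<noteq> {}\<close> by (auto simp: BR_def)
  ultimately have BR: "closed BR" by simp
  have LU: "compact L" "compact U"
  proof -
    have "compact (({0..u} \<times> D) \<inter> (BR \<inter> {p \<in> {0..u} \<times> D. fst p \<le> E (snd p)}))"
      "compact (({0..u} \<times> D) \<inter> (BR \<inter> {p \<in> {0..u} \<times> D. E (snd p) \<le> fst p}))"
      by (intro compact_Int_closed cpt closed_Int BR closed_le continuous_intros cont)+
    moreover have "{p \<in> BR. fst p \<le> E (snd p)} = ({0..u} \<times> D) \<inter> (BR \<inter> {p \<in> {0..u} \<times> D. fst p \<le> E (snd p)})"
      "{p \<in> BR. E (snd p) \<le> fst p} = ({0..u} \<times> D) \<inter> (BR \<inter> {p \<in> {0..u} \<times> D. E (snd p) \<le> fst p})"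
      by (auto simp: BR_def)
    ultimately show "compact L" "compact U"
      unfolding L_def U_def by (auto intro!: compact_continuous_image continuous_intros)
  qed
  have ex: "\<exists>s. (c, s) \<in> BR" if "c \<in> {0..u}" for c
  proof -
    have "continuous_on D (\<lambda>s. K s c)"
      unfolding K_def by (intro continuous_intros assms)
    from continuous_attains_sup[OF assms(2,3) this] show ?thesis
      using that by (auto simp: BR_def)
  qed
  \<comment> \<open>Both sets meet the interval: at 0 because all means are nonnegative, at
    \<open>u\<close> by the hypothesis \<open>high\<close>.\<close>
  have "0 \<in> L"
  proof -
    obtain s where "(0, s) \<in> BR" using ex[of 0] \<open>0 \<le> u\<close> by auto
    then have "(0, s) \<in> {p \<in> BR. fst p \<le> E (snd p)}"
      using low by (auto simp: BR_def)
    then show ?thesis unfolding L_def by force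
  qed
  moreover have "u \<in> U"
  proof -
    obtain s where s: "(u, s) \<in> BR" using ex[of u] \<open>0 \<le> u\<close> by auto
    then have "(u, s) \<in> {p \<in> BR. E (snd p) \<le> fst p}"
      using high[of s] by (auto simp: BR_def)
    then show ?thesis unfolding U_def by force
  qed
  moreover have "{0..u} \<subseteq> L \<union> U"
  proof
    fix c assume "c \<in> {0..u}"
    then obtain s where s: "(c, s) \<in> BR" using ex by blast
    show "c \<in> L \<union> U"
    proof (cases "c \<le> E s")
      case True
      then have "c \<in> L" using s unfolding L_def by force
      then show ?thesis ..
    next
      case False
      then have "c \<in> U" using s unfolding U_def by force
      then show ?thesis ..
    qed
  qed
  moreover have "L \<inter> U \<inter> {0..u} \<noteq> {}"
  proof
    assume "L \<inter> U \<inter> {0..u} = {}"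
    with connected_closedD[OF connected_Icc this] calculation LU[THEN compact_imp_closed] \<open>0 \<le> u\<close>
    show False by auto
  qed
  ultimately obtain c where "c \<in> L" "c \<in> U" "c \<in> {0..u}" by blast
  then show ?thesis
    by (auto simp: L_def U_def BR_def intro: that)
qed

lemma eventually_at_right_endD:
  assumes "eventually Q (at_right_end \<beta>)" "0 < \<beta>"
  obtains N where "ereal N < \<beta>" "\<And>u. N < u \<Longrightarrow> ereal u < \<beta> \<Longrightarrow> Q u"
proof (cases "\<beta> = \<infinity>")
  case True
  then obtain N where "\<And>u. N < u \<Longrightarrow> Q u"
    using assms by (auto simp: at_right_end_def eventually_at_top_dense)
  then show ?thesis using that[of N] True by auto
next
  case False
  then obtain r where r: "\<beta> = ereal r" using assms(2) by (cases \<beta>) auto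
  obtain N where "N < r" "\<And>u. N < u \<Longrightarrow> u < r \<Longrightarrow> Q u"
    using assms eventually_at_left[of "r - 1" r Q] by (auto simp: r at_right_end_def)
  then show ?thesis using that[of N] r by auto
qed

text \<open>Justifies the definite description in \<open>greatest_arg_max\<close>: the maximizers
  not below \<open>z0\<close> form a compact subset of \<open>[z0, N]\<close>, since
  \<open>f\<close> is strictly smaller beyond \<open>N\<close>.\<close>

lemma greatest_arg_max_exists:
  fixes f :: "real \<Rightarrow> real"
  assumes "is_arg_max f (\<lambda>w. w \<in> A) z0" "{z0..N} \<subseteq> A" "continuous_on A f"
    and far: "\<And>u. u \<in> A \<Longrightarrow> N < u \<Longrightarrow> f u < f z0"
  shows "is_greatest_arg_max f A (greatest_arg_max f A)"
proof -
  have max: "z0 \<in> A" "\<And>u. u \<in> A \<Longrightarrow> f u \<le> f z0"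
    using assms(1) by (auto simp: is_arg_max_linorder)
  then have "z0 \<le> N" using far[of z0] by force
  have iff: "is_arg_max f (\<lambda>w. w \<in> A) z \<longleftrightarrow> z \<in> A \<and> f z = f z0" for z
    using max by (auto simp: is_arg_max_linorder intro: antisym)
  have "closed ({z0..N} \<inter> f -` {f z0})"
    by (intro continuous_closed_preimage continuous_on_subset[OF assms(3,2)]) auto
  then have "compact ({z0..N} \<inter> f -` {f z0})"
    using compact_Int_closed[of "{z0..N}" "{z0..N} \<inter> f -` {f z0}"] by (simp add: Int_assoc[symmetric])
  from compact_attains_sup[OF this] \<open>z0 \<le> N\<close> obtain z where
    z: "z \<in> {z0..N}" "f z = f z0" "\<And>w. w \<in> {z0..N} \<Longrightarrow> f w = f z0 \<Longrightarrow> w \<le> z" by force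
  have "is_greatest_arg_max f A z"
    unfolding is_greatest_arg_max_def iff
  proof (intro conjI allI impI)
    show "z \<in> A" "f z = f z0" using z assms(2) by auto
    fix w assume w: "w \<in> A \<and> f w = f z0"
    show "w \<le> z"
    proof (cases "z0 \<le> w")
      case True
      then show ?thesis using z(3)[of w] far[of w] w by force
    next
      case False
      then show ?thesis using z(1) by auto
    qed
  qed
  moreover have "z' = z" if "is_greatest_arg_max f A z'" for z'
    using that calculation by (auto simp: is_greatest_arg_max_def intro: antisym)
  ultimately show ?thesis
    unfolding greatest_arg_max_def by (rule theI)
qed

section \<open>The game in terms of the scale function\<close>

locale scale_game = vanishing_scale \<beta> S for \<beta> :: ereal and S :: "real \<Rightarrow> real" +
  fixes x B :: real
  assumes decay: "((\<lambda>b. b\<^sup>2 / S b) \<longlongrightarrow> 0) (at_right_end \<beta>)"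
    and x_interior: "x \<in> state_interior \<beta>"
    and B_bound: "is_B_bound \<beta> S x B"
begin

text \<open>The value is 0 at \<open>b = \<beta>\<close> because \<beta> is almost surely not
  reached. At \<open>a = b = x\<close> the quotient \<open>0 / 0\<close> is 0, which is harmless as
  both exit points are \<open>x\<close>.\<close>

definition prob_up :: "real \<Rightarrow> real \<Rightarrow> real" where
  "prob_up a b = (if ereal b = \<beta> then 0 else (S x - scale_ext S a) / (S b - scale_ext S a))"

definition mean :: "real \<times> real \<Rightarrow> real" where
  "mean s = (1 - prob_up (fst s) (snd s)) * fst s + prob_up (fst s) (snd s) * snd s"

definition second_moment :: "real \<times> real \<Rightarrow> real" where
  "second_moment s = (1 - prob_up (fst s) (snd s)) * (fst s)\<^sup>2 + prob_up (fst s) (snd s) * (snd s)\<^sup>2"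

definition obj :: "real \<times> real \<Rightarrow> real \<Rightarrow> real" where
  "obj s c = c\<^sup>2 - 2 * c * mean s + second_moment s"

definition best_reply :: "real \<Rightarrow> real \<times> real \<Rightarrow> bool" where
  "best_reply c s \<longleftrightarrow> s \<in> {0..x} \<times> {x..B} \<and> (\<forall>s'\<in>{0..x} \<times> {x..B}. obj s' c \<le> obj s c)"

text \<open>The continuous extension of \<open>1 / S b\<close> to \<beta>. In terms of it
  \<open>prob_up\<close> is a single quotient, without a case for
  \<open>b = \<beta>\<close>.\<close>

definition inv_scale :: "real \<Rightarrow> real" where
  "inv_scale b = (if ereal b = \<beta> then 0 else 1 / S b)"

lemma obj_eq:
  "obj (a, b) c = c\<^sup>2 + (1 - prob_up a b) * (a * (a - 2 * c)) + prob_up a b * (b * (b - 2 * c))"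
  by (simp add: obj_def mean_def second_moment_def algebra_simps power2_eq_square)

lemma x_pos: "0 < x" and x_less: "ereal x < \<beta>"
  using x_interior by (auto simp: state_interior_def)

lemma scale_ext_pos_eq: "0 < a \<Longrightarrow> scale_ext S a = S a"
  by (simp add: scale_ext_def)

lemma scale_ext_nonneg: "0 \<le> a \<Longrightarrow> ereal a < \<beta> \<Longrightarrow> 0 \<le> scale_ext S a"
  by (cases "a = 0") (auto simp: scale_ext_pos_eq less_imp_le scale_pos)

lemma scale_ext_less: "0 \<le> a \<Longrightarrow> a < b \<Longrightarrow> ereal b < \<beta> \<Longrightarrow> scale_ext S a < S b"
  by (cases "a = 0") (auto simp: scale_ext_pos_eq scale_pos scale_less)

lemma scale_ext_cont: "continuous_on {0..x} (scale_ext S)"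
proof (rule continuous_on_punctured[of _ 0])
  have "continuous_on ({0..x} - {0}) S"
    by (intro continuous_on_subset[OF scale_continuous])
      (auto intro!: interior_downward[OF x_interior] simp: less_le)
  then show "continuous_on ({0..x} - {0}) (scale_ext S)"
    by (subst continuous_on_cong[OF refl, where g = S]) (auto simp: scale_ext_def)
  have "(scale_ext S \<longlongrightarrow> 0) (at_right 0)"
    using scale_left by (rule Lim_transform_eventually)
      (auto simp: eventually_at_filter scale_ext_def)
  then show "(scale_ext S \<longlongrightarrow> scale_ext S 0) (at 0 within {0..x})"
    using x_pos by (simp add: at_within_Icc_at_right)
qed

lemma B_ge_x: "x \<le> B" and B_le: "ereal B \<le> \<beta>"
proof -
  have "x \<le> B \<and> ereal B \<le> \<beta>"
  proof (cases "\<beta> < \<infinity>")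
    case True
    then have "\<beta> = ereal B" using B_bound right_end_pos by (cases \<beta>) (auto simp: is_B_bound_def)
    then show ?thesis using x_less by auto
  qed (use B_bound in \<open>auto simp: is_B_bound_def\<close>)
  then show "x \<le> B" "ereal B \<le> \<beta>" by auto
qed

lemma beta_finite: "\<beta> < \<infinity> \<Longrightarrow> \<beta> = ereal B"
  using B_bound right_end_pos by (cases \<beta>) (auto simp: is_B_bound_def)

lemma less_beta:
  assumes "x \<le> b" "b \<le> B" "ereal b \<noteq> \<beta>" shows "ereal b < \<beta>"
  using assms B_le by (metis ereal_less_eq(3) order_less_le order_trans)

lemma inv_scale_nonneg: "x \<le> b \<Longrightarrow> b \<le> B \<Longrightarrow> 0 \<le> inv_scale b"
  using x_pos less_beta scale_pos[of b] by (auto simp: inv_scale_def less_imp_le)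

lemma inv_scale_pos: "x \<le> b \<Longrightarrow> ereal b < \<beta> \<Longrightarrow> 0 < inv_scale b"
  using x_pos scale_pos[of b] by (auto simp: inv_scale_def)

lemma inv_scale_less: "x < b \<Longrightarrow> b \<le> B \<Longrightarrow> S x * inv_scale b < 1"
  using x_pos less_beta[of b] scale_less[of x b] scale_pos[of b]
  by (auto simp: inv_scale_def)

lemma inv_scale_x: "S x * inv_scale x = 1"
  using x_pos x_less scale_pos[of x] by (auto simp: inv_scale_def)

lemma inv_scale_le: "x \<le> b \<Longrightarrow> b \<le> B \<Longrightarrow> S x * inv_scale b \<le> 1"
  using inv_scale_less[of b] inv_scale_x by (cases "b = x") auto

lemma inv_scale_cont: "continuous_on {x..B} inv_scale"
proof (rule continuous_on_punctured[of _ "real_of_ereal \<beta>"])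
  have int: "b \<in> state_interior \<beta> \<and> ereal b \<noteq> \<beta>" if "b \<in> {x..B} - {real_of_ereal \<beta>}" for b
  proof -
    have "ereal b \<noteq> \<beta>" using that by (cases \<beta>) auto
    then show ?thesis using that less_beta[of b] x_pos by (auto simp: state_interior_def)
  qed
  have "continuous_on ({x..B} - {real_of_ereal \<beta>}) (\<lambda>b. 1 / S b)"
    using int scale_pos
    by (intro continuous_intros continuous_on_subset[OF scale_continuous])
      (force simp: state_interior_def)+
  then show "continuous_on ({x..B} - {real_of_ereal \<beta>}) inv_scale"
    using int by (subst continuous_on_cong[OF refl, where g = "\<lambda>b. 1 / S b"])
      (auto simp: inv_scale_def)
  show "(inv_scale \<longlongrightarrow> inv_scale (real_of_ereal \<beta>)) (at (real_of_ereal \<beta>) within {x..B})"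
  proof (cases "\<beta> < \<infinity>")
    case True
    note \<beta> = beta_finite[OF True]
    have "filterlim S at_top (at_left B)" using scale_right by (simp add: at_right_end_def \<beta>)
    then have "((\<lambda>b. inverse (S b)) \<longlongrightarrow> 0) (at_left B)"
      by (rule tendsto_inverse_0_at_top)
    moreover have "inv_scale b = inverse (S b)" if "b < B" for b
      using that by (simp only: inv_scale_def) (simp add: \<beta> divide_inverse)
    ultimately have "(inv_scale \<longlongrightarrow> 0) (at_left B)"
      by (elim Lim_transform_eventually) (auto simp: eventually_at_filter)
    moreover have "inv_scale B = 0" "real_of_ereal \<beta> = B" "x < B"
      using x_less by (simp_all only: inv_scale_def) (simp_all add: \<beta>)
    ultimately show ?thesis by (simp only: at_within_Icc_at_left)
  next
    case False
    \<comment> \<open>For infinite \<beta> the puncture sits at the default value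
      \<open>real_of_ereal \<infinity> = 0\<close>, which is outside \<open>[x, B]\<close>, so
      nothing has to be shown there.\<close>
    then have "real_of_ereal \<beta> \<notin> {x..B}" using x_pos by (cases \<beta>) auto
    then have "at (real_of_ereal \<beta>) within {x..B} = bot"
      by (subst at_within_eq_bot_iff) (simp add: closure_closed)
    then show ?thesis by simp
  qed
qed

context
  fixes a b :: real
  assumes ab: "(a, b) \<in> {0..x} \<times> {x..B}"
begin

lemma prob_up_eq:
  "prob_up a b = (S x - scale_ext S a) * inv_scale b / (1 - scale_ext S a * inv_scale b)"
  using ab x_pos less_beta[of b] scale_pos[of b]
  by (auto simp: prob_up_def inv_scale_def divide_simps)

lemma scale_ext_bounds: "0 \<le> scale_ext S a" "scale_ext S a \<le> S x"
    "a < x \<Longrightarrow> scale_ext S a < S x"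
proof -
  have "ereal a < \<beta>" using ab x_less by (auto intro: le_less_trans[of "ereal a" "ereal x"])
  then show "0 \<le> scale_ext S a" using ab by (intro scale_ext_nonneg) auto
  show "scale_ext S a < S x" if "a < x"
    using that ab x_less by (intro scale_ext_less) auto
  then show "scale_ext S a \<le> S x"
    using ab x_pos by (cases "a = x") (auto simp: scale_ext_pos_eq)
qed

text \<open>This is \<open>S a < S b\<close> in reciprocal form. Strictness comes from
  \<open>x < b\<close>, or, when \<open>b = x\<close>, from \<open>a < x\<close>.\<close>

lemma denominator_pos: "a < b \<Longrightarrow> 0 < 1 - scale_ext S a * inv_scale b"
proof -
  assume "a < b"
  have "scale_ext S a * inv_scale b \<le> S x * inv_scale b"
    using ab by (intro mult_right_mono scale_ext_bounds inv_scale_nonneg) auto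
  moreover have "scale_ext S a * inv_scale b < S x * inv_scale b" if "b = x"
    using \<open>a < b\<close> that x_less inv_scale_pos[of x]
    by (intro mult_strict_right_mono scale_ext_bounds) auto
  ultimately show ?thesis
    using inv_scale_less[of b] inv_scale_le[of b] ab by (cases "b = x") auto
qed

lemma prob_up_bounds: "0 \<le> prob_up a b" "prob_up a b \<le> 1"
proof -
  show "0 \<le> prob_up a b"
  proof (cases "a < b")
    case True
    then show ?thesis
      unfolding prob_up_eq using denominator_pos scale_ext_bounds inv_scale_nonneg[of b] ab
      by (intro divide_nonneg_pos mult_nonneg_nonneg) auto
  next
    case False
    then have "a = x" "b = x" using ab by auto
    then show ?thesis using x_pos by (simp add: prob_up_def scale_ext_pos_eq)
  qed
  show "prob_up a b \<le> 1"
  proof (cases "a < b")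
    case True
    then show ?thesis
      unfolding prob_up_eq using denominator_pos inv_scale_le[of b] ab
      by (subst divide_le_eq_1_pos) (auto simp: algebra_simps)
  next
    case False
    then have "a = x" "b = x" using ab by auto
    then show ?thesis using x_pos by (simp add: prob_up_def scale_ext_pos_eq)
  qed
qed

text \<open>The right-hand side is \<open>prob_up 0 b\<close>: lowering the lower end point to 0
  cannot make an exit at \<open>b\<close> less likely.\<close>

lemma prob_up_le: "a < b \<Longrightarrow> prob_up a b \<le> S x * inv_scale b"
proof -
  assume "a < b"
  have "scale_ext S a * inv_scale b * (S x * inv_scale b) \<le> scale_ext S a * inv_scale b * 1"
    using ab by (intro mult_left_mono mult_nonneg_nonneg scale_ext_bounds inv_scale_nonneg inv_scale_le) auto
  then show ?thesis
    unfolding prob_up_eq using denominator_pos[OF \<open>a < b\<close>]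
    by (subst pos_divide_le_eq) (auto simp: algebra_simps)
qed

lemma convex_comb_diff_le:
  "\<bar>(1 - prob_up a b) * u + prob_up a b * v - y\<bar> \<le> \<bar>u - y\<bar> + \<bar>v - y\<bar>"
proof -
  have "(1 - prob_up a b) * u + prob_up a b * v - y = (1 - prob_up a b) * (u - y) + prob_up a b * (v - y)"
    by (simp add: algebra_simps)
  also have "\<bar>\<dots>\<bar> \<le> \<bar>(1 - prob_up a b) * (u - y)\<bar> + \<bar>prob_up a b * (v - y)\<bar>"
    by (rule abs_triangle_ineq)
  also have "\<dots> \<le> 1 * \<bar>u - y\<bar> + 1 * \<bar>v - y\<bar>"
    unfolding abs_mult using prob_up_bounds by (intro add_mono mult_right_mono) auto
  finally show ?thesis by simp
qed

lemma mean_bounds: "0 \<le> mean (a, b)" "a \<le> mean (a, b)" "mean (a, b) \<le> b"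
proof -
  have "mean (a, b) = a + prob_up a b * (b - a)" by (simp add: mean_def algebra_simps)
  moreover have "0 \<le> prob_up a b * (b - a)"
    using prob_up_bounds ab by (intro mult_nonneg_nonneg) auto
  moreover have "prob_up a b * (b - a) \<le> 1 * (b - a)"
    using prob_up_bounds ab by (intro mult_right_mono) auto
  ultimately show "a \<le> mean (a, b)" "mean (a, b) \<le> b" by auto
  then show "0 \<le> mean (a, b)" using ab by auto
qed

end

lemma prob_up_0: "x \<le> b \<Longrightarrow> b \<le> B \<Longrightarrow> prob_up 0 b = S x * inv_scale b"
  using x_pos by (subst prob_up_eq) auto

text \<open>Near \<open>(x, x)\<close> the weight is 0 along \<open>a = x\<close> but 1 along
  \<open>b = x\<close> with \<open>a < x\<close>, so it has no limit. The combination still tends to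
  \<open>f x\<close>, because both averaged values do.\<close>

lemma convex_comb_cont:
  fixes f :: "real \<Rightarrow> real"
  assumes f: "continuous_on UNIV f"
  shows "continuous_on ({0..x} \<times> {x..B})
    (\<lambda>s. (1 - prob_up (fst s) (snd s)) * f (fst s) + prob_up (fst s) (snd s) * f (snd s))"
    (is "continuous_on ?D ?g")
proof (rule continuous_on_punctured[of _ "(x, x)"])
  let ?w = "\<lambda>s. (S x - scale_ext S (fst s)) * inv_scale (snd s) / (1 - scale_ext S (fst s) * inv_scale (snd s))"
  have cont: "continuous_on ?D (\<lambda>s. scale_ext S (fst s))" "continuous_on ?D (\<lambda>s. inv_scale (snd s))"
    by (rule continuous_on_compose2[OF scale_ext_cont continuous_on_fst[OF continuous_on_id]], force)
      (rule continuous_on_compose2[OF inv_scale_cont continuous_on_snd[OF continuous_on_id]], force)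
  have nz: "1 - scale_ext S (fst s) * inv_scale (snd s) \<noteq> 0" if "s \<in> ?D - {(x, x)}" for s
  proof -
    obtain a b where s: "s = (a, b)" by (cases s)
    with that have "(a, b) \<in> ?D" "a < b" by auto
    from denominator_pos[OF this] show ?thesis by (simp add: s)
  qed
  have "continuous_on (?D - {(x, x)}) ?w"
    using nz by (intro continuous_intros continuous_on_subset[OF cont(1)] continuous_on_subset[OF cont(2)]) auto
  then have w: "continuous_on (?D - {(x, x)}) (\<lambda>s. prob_up (fst s) (snd s))"
    by (subst continuous_on_cong[OF refl, where g = ?w]) (auto simp: prob_up_eq)
  have f': "continuous_on A (\<lambda>s. f (h s))" if "continuous_on A h" for A and h :: "real \<times> real \<Rightarrow> real"
    by (rule continuous_on_compose2[OF f that]) auto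
  show "continuous_on (?D - {(x, x)}) ?g"
    by (intro continuous_intros w f')
  have f_at: "((\<lambda>s. \<bar>f (h s) - f (h (x, x))\<bar>) \<longlongrightarrow> 0) (at (x, x) within ?D)"
    if "continuous_on ?D h" for h :: "real \<times> real \<Rightarrow> real"
  proof -
    have "(x, x) \<in> ?D" using x_pos B_ge_x by auto
    then have "((\<lambda>s. f (h s)) \<longlongrightarrow> f (h (x, x))) (at (x, x) within ?D)"
      using f'[OF that] unfolding continuous_on_def by (rule bspec[rotated])
    then show ?thesis
      by (intro tendsto_rabs_zero) (simp only: LIM_zero_iff)
  qed
  have lim: "((\<lambda>s. \<bar>f (fst s) - f x\<bar> + \<bar>f (snd s) - f x\<bar>) \<longlongrightarrow> 0) (at (x, x) within ?D)"
    using tendsto_add[OF f_at[OF continuous_on_fst[OF continuous_on_id]]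
        f_at[OF continuous_on_snd[OF continuous_on_id]]]
    by (simp only: fst_conv snd_conv add_0)
  have le: "norm (?g s - f x) \<le> \<bar>f (fst s) - f x\<bar> + \<bar>f (snd s) - f x\<bar>" if "s \<in> ?D" for s
    unfolding real_norm_def using convex_comb_diff_le[of "fst s" "snd s" "f (fst s)" "f (snd s)" "f x"] that
    by (simp only: prod.collapse)
  have "\<forall>\<^sub>F s in at (x, x) within ?D. norm (?g s - f x) \<le> \<bar>f (fst s) - f x\<bar> + \<bar>f (snd s) - f x\<bar>"
    unfolding eventually_at_filter by (rule always_eventually) (use le in blast)
  from Lim_null_comparison[OF this lim] have "(?g \<longlongrightarrow> f x) (at (x, x) within ?D)"
    by (simp only: LIM_zero_iff)
  moreover have "?g (x, x) = f x"
    by (simp add: algebra_simps)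
  ultimately show "(?g \<longlongrightarrow> ?g (x, x)) (at (x, x) within ?D)"
    by (simp only:)
qed

lemma mean_cont: "continuous_on ({0..x} \<times> {x..B}) mean"
  unfolding mean_def[abs_def] by (rule convex_comb_cont[where f = "\<lambda>u. u"]) (rule continuous_on_id)

lemma second_moment_cont: "continuous_on ({0..x} \<times> {x..B}) second_moment"
  unfolding second_moment_def[abs_def]
  by (rule convex_comb_cont[where f = "\<lambda>u. u\<^sup>2"]) (intro continuous_intros)

section \<open>Decay at the right end and the bounds on the strategies\<close>

lemma z_fun_tendsto: "((\<lambda>u. z_fun S c u) \<longlongrightarrow> 0) (at_right_end \<beta>)"
proof -
  have inv: "((\<lambda>u. 1 / S u) \<longlongrightarrow> 0) (at_right_end \<beta>)"
    using tendsto_inverse_0_at_top[OF scale_right] by (simp add: divide_inverse)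
  have pos: "\<forall>\<^sub>F u in at_right_end \<beta>. 1 \<le> S u"
    using scale_right by (simp add: filterlim_at_top)
  have "((\<lambda>u. u / S u) \<longlongrightarrow> 0) (at_right_end \<beta>)"
  proof (rule Lim_null_comparison)
    \<comment> \<open>The linear term is absorbed by
      \<open>\<bar>u\<bar> \<le> 1 + u\<^sup>2\<close>; both resulting quotients are known to
      vanish.\<close>
    have "\<bar>u / S u\<bar> \<le> 1 / S u + u\<^sup>2 / S u" if "1 \<le> S u" for u
    proof -
      have "\<bar>u\<bar> \<le> 1 + u\<^sup>2"
        using zero_le_power2[of "\<bar>u\<bar> - 1"] abs_ge_zero[of u]
        by (simp add: power2_diff)
      then show ?thesis using that by (simp add: abs_divide divide_simps)
    qed
    then show "\<forall>\<^sub>F u in at_right_end \<beta>. norm (u / S u) \<le> 1 / S u + u\<^sup>2 / S u"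
      using pos by (auto elim: eventually_mono)
    show "((\<lambda>u. 1 / S u + u\<^sup>2 / S u) \<longlongrightarrow> 0) (at_right_end \<beta>)"
      using tendsto_add[OF inv decay] by simp
  qed
  from tendsto_diff[OF decay tendsto_mult_left[OF this, of "2 * c"]]
  show ?thesis by (simp add: z_fun_def diff_divide_distrib)
qed

lemma z_fun_cont: "continuous_on (state_interior \<beta>) (z_fun S c)"
  unfolding z_fun_def using scale_pos
  by (intro continuous_intros scale_continuous) (force simp: state_interior_def)

text \<open>\<open>u / S u\<close> is the difference of \<open>z_fun\<close> at \<open>c = 0\<close>
  and at \<open>c = 1 / 2\<close>.\<close>

lemma ratio_tendsto: "((\<lambda>u. u / S u) \<longlongrightarrow> 0) (at_right_end \<beta>)"
  using tendsto_diff[OF z_fun_tendsto[of 0] z_fun_tendsto[of "1 / 2"]]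
  by (simp add: z_fun_def diff_divide_distrib)

text \<open>The strategy \<open>(0, u)\<close> has mean \<open>u / S u * S x\<close>, so
  \<open>M_bound\<close> dominates twice each such mean. The maximizer \<open>u_star\<close> exists
  because \<open>u / S u\<close> vanishes at infinity.\<close>

lemma M_infinite:
  assumes "\<beta> = \<infinity>"
  shows "\<And>u. x \<le> u \<Longrightarrow> 2 * (u / S u) * S x \<le> M_bound \<beta> S x" "2 * x \<le> M_bound \<beta> S x"
proof -
  let ?A = "{u. x \<le> u \<and> ereal u < \<beta>}" and ?f = "\<lambda>u. u / S u"
  have A: "?A \<subseteq> state_interior \<beta>" using x_pos by (auto simp: state_interior_def)
  have cont: "continuous_on ?A ?f"
    using A scale_pos
    by (intro continuous_intros continuous_on_subset[OF scale_continuous A]) (force simp: state_interior_def)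
  have "0 < ?f x" using x_pos x_less scale_pos by auto
  then have "\<forall>\<^sub>F u in at_right_end \<beta>. ?f u < ?f x"
    using ratio_tendsto by (simp add: order_tendsto_iff)
  then obtain N where "ereal N < \<beta>" "\<And>u. N < u \<Longrightarrow> ereal u < \<beta> \<Longrightarrow> ?f u < ?f x"
    using eventually_at_right_endD[OF _ right_end_pos] by blast
  then have N: "?f u < ?f x" if "N < u" for u
    using that assms by simp
  have "continuous_on {x..max x N} ?f"
    by (rule continuous_on_subset[OF cont]) (auto simp: assms)
  from continuous_attains_sup[OF compact_Icc _ this]
  obtain z0 where z0: "z0 \<in> {x..max x N}" "\<And>u. u \<in> {x..max x N} \<Longrightarrow> ?f u \<le> ?f z0"
    by auto
  have fx: "?f x \<le> ?f z0" using z0(2)[of x] by auto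
  have far: "?f u < ?f z0" if "max x N < u" for u
    by (rule less_le_trans[OF N fx]) (use that in simp)
  have "?f u \<le> ?f z0" if "x \<le> u" for u
  proof (cases "u \<le> max x N")
    case True
    then show ?thesis using z0(2) that by simp
  next
    case False
    then have "max x N < u" by (simp only: not_le)
    then show ?thesis by (intro less_imp_le far)
  qed
  then have "is_arg_max ?f (\<lambda>w. w \<in> ?A) z0"
    using z0(1) assms by (simp add: is_arg_max_linorder)
  then have "is_greatest_arg_max ?f ?A (u_star \<beta> S x)"
    unfolding u_star_def using cont far z0(1) assms
    by (intro greatest_arg_max_exists[where N = "max x N"]) auto
  then have max: "?f u \<le> ?f (u_star \<beta> S x)" if "x \<le> u" for u
    using that assms unfolding is_greatest_arg_max_def is_arg_max_linorder by auto
  show le: "2 * (u / S u) * S x \<le> M_bound \<beta> S x" if "x \<le> u" for u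
  proof -
    have "u / S u * (2 * S x) \<le> u_star \<beta> S x / S (u_star \<beta> S x) * (2 * S x)"
      using max[OF that] scale_pos[OF x_pos x_less] by (intro mult_right_mono) auto
    also have "\<dots> = M_bound \<beta> S x"
      unfolding M_bound_def by (simp add: assms)
    finally show ?thesis by (simp add: mult.commute mult.left_commute)
  qed
  show "2 * x \<le> M_bound \<beta> S x"
    using le[of x] scale_pos[OF x_pos x_less] by simp
qed

lemma M_finite: "\<beta> < \<infinity> \<Longrightarrow> M_bound \<beta> S x = B"
  using B_bound by (simp add: M_bound_def is_B_bound_def)

lemma M_ge_x: "x \<le> M_bound \<beta> S x"
  using M_finite M_infinite(2) B_ge_x x_pos by (cases "\<beta> < \<infinity>") auto

text \<open>Shows that \<open>d\<close>, which is \<open>b_bar\<close>, is admissible, exceeds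
  \<open>2 * c\<close>, and beats every point beyond \<open>B\<close>; cutting the strategies off at
  \<open>B\<close> therefore loses no maximizer of \<open>z_fun\<close>.\<close>

lemma B_infinite:
  assumes "\<beta> = \<infinity>" "c \<in> {0..M_bound \<beta> S x}"
  defines "d \<equiv> 3 * M_bound \<beta> S x"
  shows "d \<in> {x..B}" "2 * c < d" "\<And>u. B < u \<Longrightarrow> z_fun S c u < z_fun S c d"
proof -
  let ?M = "M_bound \<beta> S x"
  have M: "2 * x \<le> ?M" using M_infinite assms by auto
  have bbar: "b_bar \<beta> S x = d" using M_ge_x by (simp add: b_bar_def d_def)
  have d: "x < d" "0 < d" using M x_pos by (auto simp: d_def)
  show "2 * c < d" using assms(2) M x_pos by (auto simp: d_def)
  have "\<not> \<beta> < \<infinity>" using assms(1) by simp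
  then have all: "\<forall>b>B. \<forall>a\<in>{0..x}. \<forall>c\<in>{0..?M}.
      ((b - c)\<^sup>2 - (a - c)\<^sup>2) / (S b - scale_ext S a) < game_eps \<beta> S x"
    using B_bound unfolding is_B_bound_def by (auto simp only: if_False)
  \<comment> \<open>With \<open>a = 0\<close> the quotient in the condition on \<open>B\<close> is
    \<open>z_fun S c b\<close>.\<close>
  have bound: "((b - c)\<^sup>2 - (0 - c)\<^sup>2) / (S b - scale_ext S 0) < game_eps \<beta> S x"
    if "B < b" "c \<in> {0..?M}" for b c
    using all[rule_format, OF that(1) _ that(2), of 0] x_pos by simp
  have eps: "game_eps \<beta> S x \<le> z_fun S c d" if c: "c \<in> {0..?M}" for c
  proof -
    have "d - ?M \<le> d - c" "0 \<le> d - ?M" using c M x_pos by (auto simp: d_def)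
    then have "(d - ?M)\<^sup>2 \<le> (d - c)\<^sup>2" by (rule power_mono)
    moreover have "c\<^sup>2 \<le> ?M\<^sup>2" using c by (intro power_mono) auto
    moreover have "?M\<^sup>2 \<le> max (x\<^sup>2) (?M\<^sup>2)" by simp
    ultimately have "(d - ?M)\<^sup>2 - max (x\<^sup>2) (?M\<^sup>2) \<le> (d - c)\<^sup>2 - c\<^sup>2"
      by (intro diff_mono) (auto simp: le_max_iff_disj)
    also have "\<dots> = d\<^sup>2 - 2 * c * d" by (simp add: power2_diff)
    finally have "(d - ?M)\<^sup>2 - max (x\<^sup>2) (?M\<^sup>2) \<le> d\<^sup>2 - 2 * c * d" .
    then show ?thesis
      unfolding game_eps_def bbar z_fun_def using d assms(1) scale_pos[of d]
      by (intro divide_right_mono) auto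
  qed
  have gt: "z_fun S c u < game_eps \<beta> S x" if "B < u" "c \<in> {0..?M}" for u c
    using bound[OF that] by (simp add: z_fun_def power2_eq_square algebra_simps)
  show "z_fun S c u < z_fun S c d" if "B < u" for u
    using gt[OF that assms(2)] eps[OF assms(2)] by simp
  \<comment> \<open>Otherwise \<open>z_fun S c d\<close> would be both smaller than
    \<open>game_eps\<close> and at least \<open>game_eps\<close>.\<close>
  have "d \<le> B"
    using gt[of d c] eps[of c] assms(2) by force
  then show "d \<in> {x..B}" using d by auto
qed

section \<open>Shape of the best replies\<close>

lemma obj_0: "x \<le> b \<Longrightarrow> b \<le> B \<Longrightarrow> obj (0, b) c = c\<^sup>2 + S x * inv_scale b * (b * (b - 2 * c))"
  by (simp add: obj_eq prob_up_0)

lemma obj_0_z_fun: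
  "x \<le> b \<Longrightarrow> b \<le> B \<Longrightarrow> ereal b < \<beta> \<Longrightarrow> obj (0, b) c = c\<^sup>2 + S x * z_fun S c b"
  by (auto simp: obj_0 inv_scale_def z_fun_def power2_eq_square algebra_simps diff_divide_distrib)

lemma mean_0: "x \<le> b \<Longrightarrow> b \<le> B \<Longrightarrow> mean (0, b) = S x * inv_scale b * b"
  by (simp add: mean_def prob_up_0)

text \<open>A strategy with \<open>0 < a < 2 c\<close> is beaten by \<open>(0, b)\<close>: stopping at \<open>a\<close> pays less than
  \<open>c\<^sup>2\<close>, the payoff at \<open>0\<close>.\<close>

lemma best_reply_cases:
  assumes br: "best_reply c (a, b)" and gt: "c\<^sup>2 < obj (a, b) c" and c: "0 < c"
  shows "2 * c \<le> x \<and> 2 * c \<le> mean (a, b) \<or> a = 0 \<and> x < b \<and> ereal b < \<beta> \<and> 2 * c < b"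
proof -
  have ab: "(a, b) \<in> {0..x} \<times> {x..B}" using br by (simp add: best_reply_def)
  then have bnd: "0 \<le> a" "a \<le> x" "x \<le> b" "b \<le> B" by auto
  note w = prob_up_bounds[OF ab]
  have gt0: "0 < (1 - prob_up a b) * (a * (a - 2 * c)) + prob_up a b * (b * (b - 2 * c))"
    using gt by (simp add: obj_eq)
  show ?thesis
  proof (cases "2 * c \<le> a")
    case True
    then show ?thesis using mean_bounds[OF ab] bnd by auto
  next
    case a: False
    then have na: "(1 - prob_up a b) * (a * (a - 2 * c)) \<le> 0"
      using w bnd by (intro mult_nonneg_nonpos) auto
    then have pos: "0 < prob_up a b * (b * (b - 2 * c))" using gt0 by simp
    then have w0: "0 < prob_up a b" and "0 < b * (b - 2 * c)"
      using w by (auto simp: zero_less_mult_iff)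
    then have b2c: "2 * c < b" using bnd x_pos by (auto simp: zero_less_mult_iff)
    have "ereal b \<noteq> \<beta>" using w0 by (auto simp: prob_up_def)
    then have b_less: "ereal b < \<beta>" using less_beta[of b] bnd by auto
    show ?thesis
    proof (cases "b = x")
      \<comment> \<open>The process stops at once, so the mean is \<open>x\<close>, which here
        exceeds \<open>2 * c\<close>.\<close>
      case True
      then have "a < x" using a b2c by auto
      then have "prob_up a b = 1"
        using True scale_ext_less[of a x] bnd x_less by (auto simp: prob_up_def)
      then have "mean (a, b) = x" using True by (simp add: mean_def)
      then show ?thesis using True b2c by auto
    next
      case False
      then have xb: "x < b" using bnd by auto
      have "a = 0"
      proof (rule ccontr)
        assume "a \<noteq> 0"
        \<comment> \<open>The loss at \<open>a\<close> carries positive weight only because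
          \<open>x < b\<close> makes \<open>prob_up a b < 1\<close>.\<close>
        then have "a * (a - 2 * c) < 0" using bnd a by (simp add: mult_pos_neg)
        moreover have "prob_up a b \<le> S x * inv_scale b"
          using prob_up_le[OF ab] xb bnd by auto
        moreover have "S x * inv_scale b < 1" using inv_scale_less xb bnd by auto
        ultimately have "(1 - prob_up a b) * (a * (a - 2 * c)) < 0"
          "prob_up a b * (b * (b - 2 * c)) \<le> S x * inv_scale b * (b * (b - 2 * c))"
          using \<open>0 < b * (b - 2 * c)\<close> by (auto intro!: mult_pos_neg mult_right_mono)
        then have "obj (a, b) c < obj (0, b) c"
          using bnd by (simp add: obj_eq[of a] obj_0)
        moreover have "obj (0, b) c \<le> obj (a, b) c"
          using br bnd x_pos unfolding best_reply_def by auto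
        ultimately show False by simp
      qed
      then show ?thesis using xb b_less b2c by auto
    qed
  qed
qed

lemma z_fun_pos: "2 * c < b \<Longrightarrow> 0 < b \<Longrightarrow> ereal b < \<beta> \<Longrightarrow> 0 < z_fun S c b"
  using scale_pos[of b] by (auto simp: z_fun_def power2_eq_square algebra_simps)

lemma obj_gt_infinite:
  assumes "\<beta> = \<infinity>" "c \<in> {0..M_bound \<beta> S x}"
  shows "\<exists>s\<in>{0..x} \<times> {x..B}. c\<^sup>2 < obj s c"
proof -
  note d = B_infinite[OF assms]
  have "0 < S x * z_fun S c (3 * M_bound \<beta> S x)"
    using d x_pos assms(1) scale_pos[OF x_pos x_less] by (intro mult_pos_pos z_fun_pos) auto
  then have "c\<^sup>2 < obj (0, 3 * M_bound \<beta> S x) c"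
    using d assms(1) by (subst obj_0_z_fun) auto
  then show ?thesis using d x_pos by force
qed

text \<open>For finite \<beta> the bound is \<beta> itself. For infinite \<beta> the value exceeds
  \<open>c\<^sup>2\<close> and \<open>2 * M_bound \<beta> S x > x\<close>, so a best reply is some
  \<open>(0, b)\<close>, and its mean is at most half of \<open>M_bound\<close>.\<close>

lemma best_reply_M:
  assumes "s \<in> {0..x} \<times> {x..B}"
    "\<And>s'. s' \<in> {0..x} \<times> {x..B} \<Longrightarrow> obj s' (M_bound \<beta> S x) \<le> obj s (M_bound \<beta> S x)"
  shows "mean s \<le> M_bound \<beta> S x"
proof -
  obtain a b where s: "s = (a, b)" by (cases s)
  show ?thesis
  proof (cases "\<beta> < \<infinity>")
    case True
    then show ?thesis using mean_bounds(3)[of a b] assms(1) M_finite by (auto simp: s)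
  next
    case False
    then have \<beta>: "\<beta> = \<infinity>" by simp
    note M = M_infinite[OF \<beta>]
    have "(M_bound \<beta> S x)\<^sup>2 < obj s (M_bound \<beta> S x)"
      using obj_gt_infinite[OF \<beta>, of "M_bound \<beta> S x"] assms(2) M(2) x_pos by force
    moreover have "best_reply (M_bound \<beta> S x) (a, b)"
      using assms s by (auto simp: best_reply_def)
    ultimately have "a = 0 \<and> x < b"
      using best_reply_cases[of "M_bound \<beta> S x" a b] M(2) x_pos by (auto simp: s)
    then have "mean s = S x * inv_scale b * b" "x \<le> b"
      using assms(1) mean_0[of b] by (auto simp: s)
    moreover have "inv_scale b = 1 / S b" by (simp only: inv_scale_def) (simp add: \<beta>)
    ultimately have "2 * mean s = 2 * (b / S b) * S x" "x \<le> b" by auto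
    then have "2 * mean s \<le> M_bound \<beta> S x" using M(1)[of b] by (simp only:)
    then show ?thesis using M(2) x_pos by simp
  qed
qed

text \<open>At \<open>c = 0\<close> the payoff is the second moment, and stopping at once already
  yields \<open>x\<^sup>2 > 0\<close>; a best reply cannot be concentrated at 0. This excludes
  \<open>c = 0\<close> in the equilibrium.\<close>

lemma best_reply_mean_pos:
  assumes "best_reply 0 s" shows "0 < mean s"
proof -
  obtain a b where s: "s = (a, b)" by (cases s)
  have ab: "(a, b) \<in> {0..x} \<times> {x..B}" using assms by (simp add: best_reply_def s)
  have "obj (0, x) 0 \<le> obj s 0" using assms x_pos B_ge_x by (auto simp: best_reply_def)
  moreover have "obj (0, x) 0 = x\<^sup>2"
    using B_ge_x inv_scale_x by (simp add: obj_0 power2_eq_square)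
  moreover have "0 < x\<^sup>2" using x_pos by simp
  ultimately have "0 < obj s 0" by linarith
  then have "0 < (1 - prob_up a b) * (a * a) + prob_up a b * (b * b)"
    by (simp add: s obj_eq)
  then have "(1 - prob_up a b) * a \<noteq> 0 \<or> prob_up a b * b \<noteq> 0" by auto
  moreover have "0 \<le> (1 - prob_up a b) * a" "0 \<le> prob_up a b * b"
    using prob_up_bounds[OF ab] ab x_pos by (auto intro!: mult_nonneg_nonneg)
  ultimately show ?thesis unfolding s mean_def fst_conv snd_conv by linarith
qed

text \<open>If \<open>2 * c\<close> were at least \<beta>, no strategy could earn more than
  \<open>c\<^sup>2\<close>, which \<open>(0, \<beta>)\<close> earns. Both excess terms of a best
  reply would then vanish, forcing mean 0.\<close>

lemma best_reply_finite:
  assumes "\<beta> < \<infinity>" "best_reply c s" "0 < c" "c \<le> mean s"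
  shows "2 * c < B"
proof (rule ccontr)
  assume "\<not> 2 * c < B"
  obtain a b where s: "s = (a, b)" by (cases s)
  have ab: "(a, b) \<in> {0..x} \<times> {x..B}" using assms by (simp add: best_reply_def s)
  have \<beta>: "\<beta> = ereal B" by (rule beta_finite[OF assms(1)])
  then have "x < B" using x_less by simp
  have "inv_scale B = 0" by (simp only: inv_scale_def) (simp add: \<beta>)
  then have "obj (0, B) c = c\<^sup>2" using B_ge_x by (simp add: obj_0)
  moreover have "obj (0, B) c \<le> obj (a, b) c"
    using assms(2) x_pos B_ge_x by (auto simp: best_reply_def s)
  ultimately have "c\<^sup>2 \<le> obj (a, b) c" by simp
  then have ge: "0 \<le> (1 - prob_up a b) * (a * (a - 2 * c)) + prob_up a b * (b * (b - 2 * c))"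
    by (simp add: obj_eq)
  have "a < 2 * c" "b \<le> 2 * c" using ab \<open>x < B\<close> \<open>\<not> 2 * c < B\<close> by auto
  then have "(1 - prob_up a b) * (a * (a - 2 * c)) \<le> 0" "prob_up a b * (b * (b - 2 * c)) \<le> 0"
    using prob_up_bounds[OF ab] ab x_pos by (auto intro!: mult_nonneg_nonpos)
  with ge have "(1 - prob_up a b) * (a * (a - 2 * c)) = 0" "prob_up a b * (b * (b - 2 * c)) = 0"
    by linarith+
  then have z: "(1 - prob_up a b) * a = 0" "prob_up a b = 0 \<or> b = 2 * c"
    using \<open>a < 2 * c\<close> ab x_pos by auto
  have "b = B" if "b = 2 * c" using that ab \<open>\<not> 2 * c < B\<close> by auto
  then have "prob_up a b = 0" using z(2) by (auto simp: prob_up_def \<beta>[symmetric])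
  then have "mean s = 0" using z(1) by (simp add: s mean_def)
  then show False using assms by simp
qed

lemma obj_gt:
  assumes "c \<in> {0..M_bound \<beta> S x}" "\<beta> < \<infinity> \<Longrightarrow> 2 * c < B"
  shows "\<exists>s\<in>{0..x} \<times> {x..B}. c\<^sup>2 < obj s c"
proof (cases "\<beta> < \<infinity>")
  case True
  note \<beta> = beta_finite[OF True]
  \<comment> \<open>Any point strictly between \<open>max x (2 * c)\<close> and \<beta> would
    do.\<close>
  define b where "b = (max x (2 * c) + B) / 2"
  have "x < B" using x_less by (simp add: \<beta>)
  then have b: "x < b" "2 * c < b" "b < B" using assms(2)[OF True] by (auto simp: b_def)
  then have "ereal b < \<beta>" by (simp add: \<beta>)
  then have "0 < S x * z_fun S c b"
    using b x_pos scale_pos[OF x_pos x_less] by (intro mult_pos_pos z_fun_pos) auto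
  then have "c\<^sup>2 < obj (0, b) c"
    using b \<open>ereal b < \<beta>\<close> by (subst obj_0_z_fun) auto
  then show ?thesis using b x_pos by force
qed (use obj_gt_infinite assms in auto)

text \<open>Geometrically, the chord through \<open>0\<close> and a best reply \<open>b\<close> lies above the payoff on the whole
  state space when the payoff is drawn against the scale.\<close>

lemma best_reply_arg_max:
  assumes br: "best_reply c (0, b)" and b: "x < b" "ereal b < \<beta>"
    and c: "c \<in> {0..M_bound \<beta> S x}" and u: "u \<in> state_interior \<beta>"
  shows "z_fun S c u \<le> z_fun S c b" "B < u \<Longrightarrow> z_fun S c u < z_fun S c b"
proof -
  have bB: "b \<le> B" using br by (simp add: best_reply_def)
  have Sx: "0 < S x" by (rule scale_pos[OF x_pos x_less])
  have Sb: "0 < S b" "S x < S b" using b x_pos scale_pos scale_less by auto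
  have le_b: "z_fun S c v \<le> z_fun S c b" if v: "x \<le> v" "v \<le> B" "ereal v < \<beta>" for v
  proof -
    have "obj (0, v) c \<le> obj (0, b) c" using br v x_pos by (auto simp: best_reply_def)
    then have "S x * z_fun S c v \<le> S x * z_fun S c b"
      using obj_0_z_fun[of v c] obj_0_z_fun[of b c] v b bB by auto
    then show ?thesis using Sx by simp
  qed
  show less: "z_fun S c u < z_fun S c b" if "B < u"
  proof -
    \<comment> \<open>For finite \<beta> one has \<open>B = \<beta>\<close>, and no point of the
      state space lies beyond it.\<close>
    have \<beta>: "\<beta> = \<infinity>"
      using beta_finite that u by (cases "\<beta> < \<infinity>") (auto simp: state_interior_def)
    note d = B_infinite[OF \<beta> c]
    show ?thesis using d(3)[OF that] le_b[of "3 * M_bound \<beta> S x"] d(1) \<beta> by auto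
  qed
  consider "B < u" | "x \<le> u" "u \<le> B" | "u < x" by linarith
  then show "z_fun S c u \<le> z_fun S c b"
  proof cases
    \<comment> \<open>A point \<open>u\<close> below \<open>x\<close> cannot serve as an upper exit
      point, so \<open>(0, b)\<close> is compared with \<open>(u, b)\<close> instead of
      \<open>(0, u)\<close>.\<close>
    case 3
    have u0: "0 < u" "ereal u < \<beta>" using u by (auto simp: state_interior_def)
    then have Su: "0 < S u" "S u < S x" using 3 x_less scale_pos scale_less by auto
    have inv_b: "inv_scale b = 1 / S b" using b by (auto simp: inv_scale_def)
    define h where "h = b * (b - 2 * c)"
    define g where "g = u * (u - 2 * c)"
    have "obj (u, b) c \<le> obj (0, b) c"
      using br u0 3 b bB by (auto simp: best_reply_def)
    moreover have "prob_up u b = (S x - S u) / (S b - S u)"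
      using b u0 by (auto simp: prob_up_def scale_ext_pos_eq)
    ultimately have le: "(1 - (S x - S u) / (S b - S u)) * g + (S x - S u) / (S b - S u) * h \<le> S x / S b * h"
      using b bB inv_b by (simp add: obj_eq[of u] obj_0 h_def g_def)
    define w where "w = (S x - S u) / (S b - S u)"
    have w: "w * (S b - S u) = S x - S u" and q: "S x / S b * S b = S x"
      using Su Sb by (simp_all add: w_def)
    \<comment> \<open>Since \<open>(1 - w) * (S b - S u) = S b - S x\<close>, clearing denominators
      leaves the positive factor \<open>S b - S x\<close> on both sides, and cancelling it gives the
      comparison of \<open>g / S u\<close> with \<open>h / S b\<close>.\<close>
    have "(S b - S x) * g * S b = ((1 - w) * g) * ((S b - S u) * S b)"
      using w by algebra
    also have "\<dots> \<le> (S x / S b * h - w * h) * ((S b - S u) * S b)"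
      using le Su Sb by (intro mult_right_mono) (auto simp: w_def[symmetric])
    also have "\<dots> = (S x / S b * S b) * h * (S b - S u) - (w * (S b - S u)) * h * S b"
      by (simp only: algebra_simps)
    also have "\<dots> = (S b - S x) * h * S u"
      unfolding w q by (simp add: algebra_simps)
    finally have "(S b - S x) * (g * S b) \<le> (S b - S x) * (h * S u)" by (simp add: mult.assoc)
    then have "g * S b \<le> h * S u" using Sb by simp
    then have "g / S u \<le> h / S b" using Su Sb by (simp add: divide_simps mult.commute)
    then show ?thesis
      by (simp add: z_fun_def g_def h_def power2_eq_square algebra_simps)
  qed (use less le_b u in \<open>auto simp: state_interior_def intro: less_imp_le\<close>)
qed

text \<open>Both points give the same value of \<open>(z - 2 * c) * (z / S z)\<close>. The first
  factor is positive and no smaller at the greatest maximizer, so \<open>z / S z\<close>, which is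
  proportional to the mean, is no larger there.\<close>

lemma greatest_best_reply:
  assumes br: "best_reply c (0, b)" and b: "x < b" "ereal b < \<beta>" "2 * c < b"
    and c: "c \<in> {0..M_bound \<beta> S x}"
  shows "is_greatest_arg_max (z_fun S c) (state_interior \<beta>) (z_of \<beta> S c)"
    "best_reply c (0, z_of \<beta> S c)" "mean (0, z_of \<beta> S c) \<le> mean (0, b)"
proof -
  define z where "z = z_of \<beta> S c"
  have k: "0 < z_fun S c b" using b x_pos by (intro z_fun_pos) auto
  have bB: "b \<le> B" using br by (simp add: best_reply_def)
  note max = best_reply_arg_max[OF br b(1,2) c]
  have "\<forall>\<^sub>F u in at_right_end \<beta>. z_fun S c u < z_fun S c b"
    using z_fun_tendsto k by (rule order_tendstoD)
  then obtain N where N: "ereal N < \<beta>" "\<And>u. N < u \<Longrightarrow> ereal u < \<beta> \<Longrightarrow> z_fun S c u < z_fun S c b"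
    using eventually_at_right_endD[OF _ right_end_pos] by blast
  have "is_arg_max (z_fun S c) (\<lambda>w. w \<in> state_interior \<beta>) b"
    using max(1) b x_pos by (auto simp: is_arg_max_linorder interiorI)
  moreover have "{b..N} \<subseteq> state_interior \<beta>"
    using N(1) b x_pos by (auto simp: state_interior_def intro: le_less_trans[of _ "ereal N"])
  ultimately show *: "is_greatest_arg_max (z_fun S c) (state_interior \<beta>) (z_of \<beta> S c)"
    unfolding z_of_def using N(2)
    by (intro greatest_arg_max_exists[where N = N] z_fun_cont) (auto simp: state_interior_def)
  have bmax: "is_arg_max (z_fun S c) (\<lambda>w. w \<in> state_interior \<beta>) b"
    using max(1) b x_pos by (auto simp: is_arg_max_linorder interiorI)
  then have "b \<le> z" using * by (simp add: is_greatest_arg_max_def z_def)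
  have zint: "z \<in> state_interior \<beta>" and zeq: "z_fun S c z = z_fun S c b"
    using * bmax by (auto simp: is_greatest_arg_max_def is_arg_max_linorder z_def intro: antisym)
  \<comment> \<open>A maximizer over the whole state space is admissible, since points beyond
    \<open>B\<close> are strictly worse than \<open>b\<close>.\<close>
  have zB: "z \<le> B" using max(2)[OF zint] zeq by force
  have z\<beta>: "ereal z < \<beta>" using zint by (simp add: state_interior_def)
  have "obj (0, z) c = obj (0, b) c"
    using zeq \<open>b \<le> z\<close> zB z\<beta> b bB by (simp add: obj_0_z_fun)
  then show "best_reply c (0, z_of \<beta> S c)"
    using br \<open>b \<le> z\<close> zB b by (auto simp: best_reply_def z_def[symmetric])
  have Sz: "0 < S z" "0 < S b" using scale_pos[of z] scale_pos[of b] b x_pos \<open>b \<le> z\<close> z\<beta> by auto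
  have "(z - 2 * c) * (z / S z) = (b - 2 * c) * (b / S b)"
    using zeq by (simp add: z_fun_def power2_eq_square algebra_simps diff_divide_distrib)
  moreover have "(b - 2 * c) * (z / S z) \<le> (z - 2 * c) * (z / S z)"
    using \<open>b \<le> z\<close> b x_pos Sz by (intro mult_right_mono) auto
  ultimately have "(b - 2 * c) * (z / S z) \<le> (b - 2 * c) * (b / S b)" by simp
  then have "z / S z \<le> b / S b" by (rule mult_left_le_imp_le) (use b in simp)
  then have "S x * (z / S z) \<le> S x * (b / S b)"
    using scale_pos[OF x_pos x_less] by (intro mult_left_mono) auto
  then show "mean (0, z_of \<beta> S c) \<le> mean (0, b)"
    using \<open>b \<le> z\<close> zB b bB z\<beta> by (auto simp: z_def[symmetric] mean_0 inv_scale_def)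
qed

text \<open>A uniform bound, needed for integrability against arbitrary mixed strategies of the
  inf-player.\<close>

lemma obj_bound:
  assumes "s \<in> {0..x} \<times> {x..B}" "c \<in> {0..M_bound \<beta> S x}"
  shows "obj s c \<le> (B + M_bound \<beta> S x)\<^sup>2"
proof -
  obtain a b where s: "s = (a, b)" by (cases s)
  have ab: "(a, b) \<in> {0..x} \<times> {x..B}" using assms(1) s by simp
  have "(a - c)\<^sup>2 \<le> (B + M_bound \<beta> S x)\<^sup>2" "(b - c)\<^sup>2 \<le> (B + M_bound \<beta> S x)\<^sup>2"
    using ab assms(2) x_pos by (auto simp: abs_le_square_iff[symmetric] abs_le_iff)
  then have "(1 - prob_up a b) * (a - c)\<^sup>2 + prob_up a b * (b - c)\<^sup>2 \<le> (B + M_bound \<beta> S x)\<^sup>2"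
    using prob_up_bounds[OF ab] by (intro convex_bound_le) auto
  then show ?thesis by (simp add: s obj_eq power2_eq_square algebra_simps)
qed

lemma equilibrium:
  obtains c a b p where
    "c \<in> {0..M_bound \<beta> S x}" "p \<in> {0..1}"
    "is_greatest_arg_max (z_fun S c) (state_interior \<beta>) (z_of \<beta> S c)"
    "best_reply c (a, b)" "best_reply c (0, z_of \<beta> S c)"
    "p * mean (a, b) + (1 - p) * mean (0, z_of \<beta> S c) = c"
proof -
  let ?D = "{0..x} \<times> {x..B}"
  have "compact ?D" "?D \<noteq> {}" using x_pos B_ge_x by (auto intro: compact_Times)
  moreover have "0 \<le> M_bound \<beta> S x" using M_ge_x x_pos by simp
  moreover have "0 \<le> mean s" if "s \<in> ?D" for s
    using mean_bounds(1)[of "fst s" "snd s"] that by simp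
  ultimately obtain c s1 s2 where c: "c \<in> {0..M_bound \<beta> S x}"
    and D: "s1 \<in> ?D" "s2 \<in> ?D"
    and br: "\<And>s. s \<in> ?D \<Longrightarrow> obj s c \<le> obj s1 c" "\<And>s. s \<in> ?D \<Longrightarrow> obj s c \<le> obj s2 c"
    and le: "mean s2 \<le> c" "c \<le> mean s1"
    using balanced_best_replies[of ?D mean second_moment "M_bound \<beta> S x"]
      mean_cont second_moment_cont best_reply_M unfolding obj_def by blast
  have br1: "best_reply c s1" and br2: "best_reply c s2"
    using D br by (auto simp: best_reply_def)
  \<comment> \<open>At \<open>c = 0\<close> the mean of \<open>s2\<close> would be positive and yet
    at most \<open>c\<close>.\<close>
  have "c \<noteq> 0" using best_reply_mean_pos[of s2] br2 le(1) by auto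
  then have "0 < c" using c by simp
  then have "\<exists>s\<in>?D. c\<^sup>2 < obj s c"
    using best_reply_finite[OF _ br1] le c by (intro obj_gt) auto
  then have gt: "c\<^sup>2 < obj s2 c" using br(2) by force
  obtain a2 b2 where s2: "s2 = (a2, b2)" by (cases s2)
  \<comment> \<open>The other alternative, a mean of at least \<open>2 * c\<close>, contradicts
    \<open>mean s2 \<le> c\<close> and \<open>0 < c\<close>.\<close>
  have b2: "a2 = 0" "x < b2" "ereal b2 < \<beta>" "2 * c < b2"
    using best_reply_cases[of c a2 b2] br2 gt \<open>0 < c\<close> le by (auto simp: s2)
  note z = greatest_best_reply[OF br2[unfolded s2 b2(1)] b2(2-4) c]
  define e1 e2 where "e1 = mean s1" and "e2 = mean (0, z_of \<beta> S c)"
  have e: "e2 \<le> c" "c \<le> e1" using z(3) le by (auto simp: e1_def e2_def s2 b2(1))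
  \<comment> \<open>The weight solves \<open>p * e1 + (1 - p) * e2 = c\<close>; if
    \<open>e1 = e2\<close>, both equal \<open>c\<close> and any weight works.\<close>
  define p where "p = (if e1 = e2 then 1 else (c - e2) / (e1 - e2))"
  have p: "p \<in> {0..1}" "p * e1 + (1 - p) * e2 = c"
  proof -
    show "p \<in> {0..1}" using e by (auto simp: p_def)
    show "p * e1 + (1 - p) * e2 = c"
    proof (cases "e1 = e2")
      case False
      then have "p * (e1 - e2) = c - e2" by (simp add: p_def)
      then show ?thesis by (simp add: algebra_simps)
    qed (use e in \<open>simp add: p_def\<close>)
  qed
  show ?thesis
    using that[of c p "fst s1" "snd s1"] c p z br1 by (simp add: e1_def e2_def)
qed

end

section \<open>Mixed strategies\<close>

text \<open>Nonnegativity of \<open>A\<close> allows the product expectation to be computed as an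
  iterated \<open>nn_integral\<close>, so integrability over the product need not be established
  first.\<close>

lemma expectation_two_point:
  fixes A :: "'s \<Rightarrow> real \<Rightarrow> real"
  assumes "\<And>s c. 0 \<le> A s c" and p: "p \<in> {0..1}"
    and int: "integrable (measure_pmf q) (A s1)" "integrable (measure_pmf q) (A s2)"
  shows "mixed_payoff A (two_point p s1 s2) q =
    p * measure_pmf.expectation q (A s1) + (1 - p) * measure_pmf.expectation q (A s2)"
proof -
  let ?E = "\<lambda>s. measure_pmf.expectation q (A s)"
  have nn: "0 \<le> ?E s" for s using assms(1) by simp
  have "mixed_payoff A (two_point p s1 s2) q =
      enn2real (\<integral>\<^sup>+z. ennreal (case z of (s, c) \<Rightarrow> A s c) \<partial>pair_pmf (two_point p s1 s2) q)"
    unfolding mixed_payoff_def using assms(1) by (intro integral_eq_nn_integral) (auto split: prod.split)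
  also have "(\<integral>\<^sup>+z. ennreal (case z of (s, c) \<Rightarrow> A s c) \<partial>pair_pmf (two_point p s1 s2) q) =
      (\<integral>\<^sup>+c. ennreal (A s1 c) \<partial>q) * ennreal p + (\<integral>\<^sup>+c. ennreal (A s2 c) \<partial>q) * ennreal (1 - p)"
    using p by (simp add: nn_integral_pair_pmf' two_point_def)
  also have "\<dots> = ennreal (?E s1) * ennreal p + ennreal (?E s2) * ennreal (1 - p)"
    using int assms(1) by (simp add: nn_integral_eq_integral)
  also have "\<dots> = ennreal (p * ?E s1 + (1 - p) * ?E s2)"
    using p nn by (simp add: ennreal_mult[symmetric] ennreal_plus[symmetric] mult.commute del: ennreal_plus)
  finally show ?thesis using p nn by (simp del: ennreal_plus)
qed

lemma mixed_payoff_return_le: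
  fixes A :: "'s \<Rightarrow> real \<Rightarrow> real"
  assumes "\<And>s. s \<in> D \<Longrightarrow> 0 \<le> A s c" "\<And>s. s \<in> D \<Longrightarrow> A s c \<le> V" "y \<in> mixed D"
  shows "mixed_payoff A y (return_pmf c) \<le> V"
proof -
  have supp: "AE s in measure_pmf y. s \<in> D"
    using assms(3) by (auto simp: mixed_def AE_measure_pmf_iff)
  have "integrable (measure_pmf y) (\<lambda>s. A s c)"
    using supp assms by (intro measure_pmf.integrable_const_bound[of _ V]) (auto elim!: eventually_mono)
  then have "measure_pmf.expectation y (\<lambda>s. A s c) \<le> V"
    using supp assms(2) by (intro measure_pmf.integral_le_const) (auto elim!: eventually_mono)
  then show ?thesis by (simp add: mixed_payoff_def pair_return_pmf2)
qed

text \<open>An abstract principle: for payoffs quadratic in \<open>c\<close> with leading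
  coefficient 1, two best replies whose mixed mean is \<open>c\<close> already yield the value, the
  optimal strategies and uniqueness.\<close>

lemma quadratic_saddle_point:
  fixes A :: "'s \<Rightarrow> real \<Rightarrow> real" and E Q :: "'s \<Rightarrow> real"
  assumes nonneg: "\<And>s c. 0 \<le> A s c"
    and quad: "\<And>s c. s \<in> D \<Longrightarrow> A s c = c\<^sup>2 - 2 * c * E s + Q s"
    and bound: "\<And>s c. s \<in> D \<Longrightarrow> c \<in> C \<Longrightarrow> A s c \<le> K"
    and D: "s1 \<in> D" "s2 \<in> D" and c: "c \<in> C" and p: "p \<in> {0..1}"
    and best: "\<And>s. s \<in> D \<Longrightarrow> A s c \<le> V" "A s1 c = V" "A s2 c = V"
    and balance: "p * E s1 + (1 - p) * E s2 = c"
  shows "has_value A D C V" "optimal_inf A D C V (return_pmf c)"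
    "optimal_sup A D C V (two_point p s1 s2)"
    "V = mixed_payoff A (two_point p s1 s2) (return_pmf c)"
    "is_arg_min (\<lambda>c. SUP s\<in>D. ereal (A s c)) (\<lambda>c. c \<in> C) c' \<longleftrightarrow> c' = c"
    "essential A D C V c s1" "essential A D C V c s2"
proof -
  let ?y = "two_point p s1 s2"
  have mix: "p * A s1 c' + (1 - p) * A s2 c' = V + (c' - c)\<^sup>2" for c'
  proof -
    \<comment> \<open>Exact expansion around \<open>c\<close>; mixing the two strategies cancels the
      linear term by \<open>balance\<close>.\<close>
    have gap: "A s c' = A s c + (c' - c)\<^sup>2 + 2 * (c' - c) * (c - E s)" if "s \<in> D" for s
      by (simp add: quad[OF that] power2_eq_square algebra_simps)
    have "p * A s1 c' + (1 - p) * A s2 c' =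
        V + (c' - c)\<^sup>2 + 2 * (c' - c) * (c - (p * E s1 + (1 - p) * E s2))"
      unfolding gap[OF D(1)] gap[OF D(2)] best(2,3) by (simp add: algebra_simps)
    then show ?thesis by (simp add: balance)
  qed
  have y: "?y \<in> mixed D" using D by (auto simp: mixed_def two_point_def)
  have r: "return_pmf c \<in> mixed C" using c by (simp add: mixed_def)
  have upper: "mixed_payoff A y (return_pmf c) \<le> V" if "y \<in> mixed D" for y
    using mixed_payoff_return_le[of D A c V y] nonneg best(1) that by blast
  have lower: "V \<le> mixed_payoff A ?y q" if q: "q \<in> mixed C" for q
  proof -
    have supp: "AE c in measure_pmf q. c \<in> C"
      using q by (auto simp: mixed_def AE_measure_pmf_iff)
    have int: "integrable (measure_pmf q) (A s)" if "s \<in> D" for s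
      using supp bound[OF that] nonneg
      by (intro measure_pmf.integrable_const_bound[of _ K]) (auto elim!: eventually_mono)
    have "mixed_payoff A ?y q = measure_pmf.expectation q (\<lambda>c'. p * A s1 c' + (1 - p) * A s2 c')"
      unfolding expectation_two_point[where A = A, OF nonneg p int[OF D(1)] int[OF D(2)]]
      using int[OF D(1)] int[OF D(2)] by simp
    also have "\<dots> \<ge> V"
      by (intro measure_pmf.integral_ge_const Bochner_Integration.integrable_add integrable_mult_right
          int D) (simp add: mix)
    finally show ?thesis .
  qed
  show inf: "optimal_inf A D C V (return_pmf c)"
    using r upper by (simp add: optimal_inf_def)
  show "optimal_sup A D C V ?y"
    using y lower by (simp add: optimal_sup_def)
  show "V = mixed_payoff A ?y (return_pmf c)"
    using upper[OF y] lower[OF r] by (rule antisym[rotated])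
  show "has_value A D C V"
    unfolding has_value_def
  proof
    have "ereal V \<le> (INF q\<in>mixed C. ereal (mixed_payoff A ?y q))"
      using lower by (intro INF_greatest) simp
    also have "\<dots> \<le> (SUP y\<in>mixed D. INF q\<in>mixed C. ereal (mixed_payoff A y q))"
      using y by (rule SUP_upper)
    finally have "ereal V \<le> (SUP y\<in>mixed D. INF q\<in>mixed C. ereal (mixed_payoff A y q))" .
    moreover have "(SUP y\<in>mixed D. INF q\<in>mixed C. ereal (mixed_payoff A y q)) \<le> ereal V"
      using upper by (intro SUP_least INF_lower2[OF r]) simp
    ultimately show "ereal V = (SUP y\<in>mixed D. INF q\<in>mixed C. ereal (mixed_payoff A y q))"
      by (rule antisym)
    have "(INF q\<in>mixed C. SUP y\<in>mixed D. ereal (mixed_payoff A y q)) \<le> ereal V"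
      using upper by (intro INF_lower2[OF r] SUP_least) simp
    moreover have "ereal V \<le> (INF q\<in>mixed C. SUP y\<in>mixed D. ereal (mixed_payoff A y q))"
      using lower by (intro INF_greatest SUP_upper2[OF y]) simp
    ultimately show "ereal V = (INF q\<in>mixed C. SUP y\<in>mixed D. ereal (mixed_payoff A y q))"
      by (rule antisym[rotated])
  qed
  let ?g = "\<lambda>c. SUP s\<in>D. ereal (A s c)"
  have at_c: "?g c \<le> ereal V" using best(1) by (intro SUP_least) simp
  \<comment> \<open>The better of the two pure strategies earns at least as much as the mixture, so
    the supremum over pure strategies already grows quadratically away from
    \<open>c\<close>.\<close>
  have above: "ereal (V + (c' - c)\<^sup>2) \<le> ?g c'" for c'
  proof -
    have "V + (c' - c)\<^sup>2 \<le> max (A s1 c') (A s2 c')"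
      unfolding mix[symmetric] using p by (intro convex_bound_le) auto
    then have "ereal (V + (c' - c)\<^sup>2) \<le> ereal (A s1 c') \<or> ereal (V + (c' - c)\<^sup>2) \<le> ereal (A s2 c')"
      by (auto simp: le_max_iff_disj)
    then show ?thesis using D by (blast intro: SUP_upper2)
  qed
  have less: "?g c < ?g c'" if "c' \<noteq> c" for c'
  proof -
    have "ereal V < ereal (V + (c' - c)\<^sup>2)" using that by simp
    then show ?thesis using at_c above[of c'] by (meson le_less_trans less_le_trans)
  qed
  show "is_arg_min ?g (\<lambda>c. c \<in> C) c' \<longleftrightarrow> c' = c"
  proof
    assume "is_arg_min ?g (\<lambda>c. c \<in> C) c'"
    then have "?g c' \<le> ?g c" using c by (simp add: is_arg_min_linorder)
    then show "c' = c" using less[of c'] by (auto simp: not_less[symmetric])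
  next
    assume "c' = c"
    then show "is_arg_min ?g (\<lambda>c. c \<in> C) c'"
      using c less by (auto simp: is_arg_min_def dest: less_asym)
  qed
  show "essential A D C V c s1" "essential A D C V c s2"
    using inf D best by (simp_all add: essential_def)
qed

theorem theorem4p7:
  fixes M :: "'w measure" and F :: "ennreal \<Rightarrow> 'w measure" and P :: "real \<Rightarrow> 'w measure"
    and X :: "real \<Rightarrow> 'w \<Rightarrow> ereal" and \<beta> :: ereal and S :: "real \<Rightarrow> real" and m :: "real measure"
    and x B :: real
  defines "A \<equiv> payoff P X \<beta> x"
    and "D \<equiv> {0..x} \<times> {x..B}"
    and "C \<equiv> {0..M_bound \<beta> S x}"
  assumes diffusion: "linear_diffusion M F P X \<beta> S m"
    and scale_left: "(S \<longlongrightarrow> 0) (at_right 0)"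
    and scale_right: "filterlim S at_top (at_right_end \<beta>)"
    and hit_decay: "((\<lambda>b. measure (P x) {\<omega> \<in> space M. hit_time X (ereal b) \<omega> < \<infinity>} * b\<^sup>2) \<longlongrightarrow> 0)
      (at_right_end \<beta>)"
    and x_interior: "x \<in> state_interior \<beta>"
    and B_bound: "is_B_bound \<beta> S x B"
  shows "\<exists>V c z a b p.
      is_greatest_arg_max (z_fun S c) (state_interior \<beta>) z \<and> z = z_of \<beta> S c \<and>
      (a, b) \<in> D \<and> p \<in> {0..1} \<and>
      has_value A D C V \<and>
      optimal_inf A D C V (return_pmf c) \<and>
      optimal_sup A D C V (two_point p (a, b) (0, z)) \<and>
      V = mixed_payoff A (two_point p (a, b) (0, z)) (return_pmf c) \<and>
      (\<forall>c'. is_arg_min (\<lambda>c. SUP s\<in>D. ereal (A s c)) (\<lambda>c. c \<in> C) c' \<longleftrightarrow> c' = c) \<and>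
      essential A D C V c (a, b) \<and> essential A D C V c (0, z)"
proof -
  interpret diff: linear_diffusion M F P X \<beta> S m by (rule diffusion)
  interpret vanishing_scale \<beta> S
    by unfold_locales (fact diff.pos_right_end diff.scale_mono diff.scale_cont scale_left scale_right)+
  interpret vanishing_scale_diffusion M F P X \<beta> S m ..
  interpret scale_game \<beta> S x B
    by unfold_locales (fact scale_decay[OF x_interior hit_decay] x_interior B_bound)+
  \<comment> \<open>The bridge from the diffusion to the analytic game.\<close>
  have A_obj: "A s c = obj s c" if "s \<in> D" for s c
  proof -
    obtain a b where s: "s = (a, b)" by (cases s)
    then have "A s c = (1 - prob_up a b) * (a - c)\<^sup>2 + prob_up a b * (b - c)\<^sup>2"
      using that payoff_eq[OF x_interior, of a b c] order_trans[OF _ B_le, of "ereal b"]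
      by (simp add: A_def D_def prob_up_def)
    then show ?thesis by (simp add: s obj_eq power2_eq_square algebra_simps)
  qed
  obtain c a b p where eq: "c \<in> {0..M_bound \<beta> S x}" "p \<in> {0..1}"
    "is_greatest_arg_max (z_fun S c) (state_interior \<beta>) (z_of \<beta> S c)"
    "best_reply c (a, b)" "best_reply c (0, z_of \<beta> S c)"
    "p * mean (a, b) + (1 - p) * mean (0, z_of \<beta> S c) = c"
    by (rule equilibrium)
  let ?z = "z_of \<beta> S c"
  have D: "(a, b) \<in> D" "(0, ?z) \<in> D"
    using eq(4,5) by (simp_all add: best_reply_def D_def)
  have best: "A s c \<le> A (a, b) c" "A s c \<le> A (0, ?z) c" if "s \<in> D" for s
    unfolding A_obj[OF that] A_obj[OF D(1)] A_obj[OF D(2)]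
    using eq(4,5) that unfolding best_reply_def D_def by blast+
  note saddle = quadratic_saddle_point[where A = A and D = D and C = C and E = mean
      and Q = second_moment and K = "(B + M_bound \<beta> S x)\<^sup>2" and ?s1.0 = "(a, b)" and ?s2.0 = "(0, ?z)"
      and V = "A (a, b) c" and c = c and p = p]
  have "0 \<le> A s c" for s c
    by (simp add: A_def payoff_def)
  moreover have "A s c = c\<^sup>2 - 2 * c * mean s + second_moment s" if "s \<in> D" for s c
    using A_obj[OF that] by (simp add: obj_def)
  moreover have "A s c \<le> (B + M_bound \<beta> S x)\<^sup>2" if "s \<in> D" "c \<in> C" for s c
    using obj_bound[of s c] A_obj that by (simp add: D_def C_def)
  moreover have "A (0, ?z) c = A (a, b) c"
    using best D by (intro antisym) auto
  ultimately have "has_value A D C (A (a, b) c) \<and>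
      optimal_inf A D C (A (a, b) c) (return_pmf c) \<and>
      optimal_sup A D C (A (a, b) c) (two_point p (a, b) (0, ?z)) \<and>
      A (a, b) c = mixed_payoff A (two_point p (a, b) (0, ?z)) (return_pmf c) \<and>
      (\<forall>c'. is_arg_min (\<lambda>c. SUP s\<in>D. ereal (A s c)) (\<lambda>c. c \<in> C) c' \<longleftrightarrow> c' = c) \<and>
      essential A D C (A (a, b) c) c (a, b) \<and> essential A D C (A (a, b) c) c (0, ?z)"
    using D best eq(1,2,6) by (intro conjI allI saddle) (simp_all add: C_def)
  then show ?thesis using eq(2,3) D by blast
qed

end
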